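(* Let $q$ be a positive integer. Then $$\chi_\mathcal{L}(q) =(-1)^{\mathrm{rk}(E)}q^{\mathrm{rk}(G)-\mathrm{rk}(E)}Q_\mathcal{L}(1-q,0), \qquad \chi_\mathcal{L}^*(q)=(-1)^{|E|-\mathrm{rk}(E)}\left(m(\emptyset)\right)^{-1}Q_\mathcal{L}(0,1-q).$$ In particular, if $q \in \mathbb{Z}_M(\mathcal{L})$, then $$\chi_\mathcal{L}(q) = (-1)^{\mathrm{rk}(E)}q^{\mathrm{rk}(G)-\mathrm{rk}(E)}T_\mathcal{L}(1-q,0), \qquad \chi_\mathcal{L}^*(q)= (-1)^{|E|-\mathrm{rk}(E)}T_\mathcal{L}(0,1-q).$$ If, on the other hand, $q \in \mathbb{Z}_A(\mathcal{L})$, then $$\chi_\mathcal{L}(q) = (-1)^{\mathrm{rk}(E)}q^{\mathrm{rk}(G)-\mathrm{rk}(E)}M_\mathcal{L}(1-q,0), \qquad \chi_\mathcal{L}^*(q)= (-1)^{|E|-\mathrm{rk}(E)}M_\mathcal{L}(0,1-q).$$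
   Context: Let $\mathcal{L}=(g_e)_{e \in E}$ be a finite list of elements of a finitely generated abelian group $G$. For $A\subseteq E$, let $\mathcal{L}_A=(g_e)_{e\in A}$, $\mathrm{rk}(A)$ the rank of $\langle\mathcal{L}_A\rangle$, $G_A$ the torsion subgroup of $G/\langle \mathcal{L}_A\rangle$, $m(A):=|G_A|$. Define $T_\mathcal{L}(x,y)=\sum_{A\subseteq E}(x-1)^{\mathrm{rk}(E)-\mathrm{rk}(A)}(y-1)^{|A|-\mathrm{rk}(A)}$ (Tutte polynomial), $M_\mathcal{L}(x,y)=\sum_{A\subseteq E}m(A)(x-1)^{\mathrm{rk}(E)-\mathrm{rk}(A)}(y-1)^{|A|-\mathrm{rk}(A)}$ (arithmetic Tutte polynomial), and the Tutte quasi-polynomial $Q_\mathcal{L}(x,y) := \sum_{A \subseteq E} \frac{|G_A|}{|(x-1)(y-1) G_A|}(x-1)^{\mathrm{rk}(E)-\mathrm{rk}(A)}(y-1)^{|A|-\mathrm{rk}(A)}$. A proper $(\mathcal{L},q)$-coloring is $\phi \in \mathrm{Hom}(G,\mathbb{Z}/q\mathbb{Z})$ with $\phi(g_e) \neq 0$ for all $e \in E$; $\chi_\mathcal{L}(q)$ is their number. A nowhere-zero $(\mathcal{L},q)$-flow is a map $\phi : E \rightarrow (\mathbb{Z}/q\mathbb{Z}) \setminus \{0\}$ with $\sum_{e \in E} \phi(e)g_e = 0$ in $G/qG$; $\chi_\mathcal{L}^*(q)$ is their number. Let $N$ be the least common multiple of $m(B)$ over all bases $B\subseteq E$; $\mathbb{Z}_M(\mathcal{L})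 := \{q \in \mathbb{Z}_{>0} : \gcd(q, N)=1\}$ and $\mathbb{Z}_A(\mathcal{L}) := \{q \in \mathbb{Z}_{>0} : qG_B=(0) \text{ for all bases } B\}$.
   Formalization: The flow formulas are corrected for G with torsion: in the general formula m(∅)^{-1} becomes (|G_∅|/|qG_∅|)^{-1}, and in the Z_A formula a factor m(∅)^{-1} is added; as printed they fail for G=Z/3, g=(0), q=2 and for G=Z/2, E=∅, q=2 respectively. *)

theory Defs
  imports "HOL-Algebra.Algebra"
begin

text \<open>
  Abelian groups are commutative groups of \<open>HOL-Algebra\<close>, hence written multiplicatively: the
  multiple \<open>k x\<close> of the additive notation is \<open>x [^] k\<close>. A list \<open>(g\<^sub>e)\<close> with index set \<open>E\<close> is a
  function \<open>g\<close> that is only used on \<open>E\<close>.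
\<close>

definition finitely_generated_group :: "('a, 'b) monoid_scheme \<Rightarrow> bool" where
  "finitely_generated_group G \<longleftrightarrow>
     (\<exists>S. finite S \<and> S \<subseteq> carrier G \<and> generate G S = carrier G)"

definition torsion_set :: "('a, 'b) monoid_scheme \<Rightarrow> 'a set" where
  "torsion_set H = {x \<in> carrier H. \<exists>n::nat. n > 0 \<and> x [^]\<^bsub>H\<^esub> n = \<one>\<^bsub>H\<^esub>}"

definition multiples :: "('a, 'b) monoid_scheme \<Rightarrow> int \<Rightarrow> 'a set \<Rightarrow> 'a set" where
  "multiples H k S = (\<lambda>x. x [^]\<^bsub>H\<^esub> k) ` S"

definition int_independent :: "('a, 'b) monoid_scheme \<Rightarrow> 'a set \<Rightarrow> bool" where
  "int_independent H S \<longleftrightarrow> finite S \<and> S \<subseteq> carrier H \<and>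
     (\<forall>c :: 'a \<Rightarrow> int. (\<Otimes>\<^bsub>H\<^esub>s\<in>S. s [^]\<^bsub>H\<^esub> c s) = \<one>\<^bsub>H\<^esub> \<longrightarrow> (\<forall>s\<in>S. c s = 0))"

text \<open>
  The maximum is taken over a finite set when \<open>H\<close> is a finitely generated abelian group, because
  a set of generators bounds the size of the independent sets.
\<close>

definition abelian_rank :: "('a, 'b) monoid_scheme \<Rightarrow> nat" where
  "abelian_rank H = Max {card S |S. int_independent H S}"

definition rk :: "('a, 'b) monoid_scheme \<Rightarrow> ('e \<Rightarrow> 'a) \<Rightarrow> 'e set \<Rightarrow> nat" where
  "rk G g A = abelian_rank (subgroup_generated G (g ` A))"

definition list_quotient ::
    "('a, 'b) monoid_scheme \<Rightarrow> ('e \<Rightarrow> 'a) \<Rightarrow> 'e set \<Rightarrow> 'a set monoid" where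
  "list_quotient G g A = G Mod generate G (g ` A)"

definition quotient_torsion ::
    "('a, 'b) monoid_scheme \<Rightarrow> ('e \<Rightarrow> 'a) \<Rightarrow> 'e set \<Rightarrow> 'a set set" where
  "quotient_torsion G g A = torsion_set (list_quotient G g A)"

definition arith_mult :: "('a, 'b) monoid_scheme \<Rightarrow> ('e \<Rightarrow> 'a) \<Rightarrow> 'e set \<Rightarrow> nat" where
  "arith_mult G g A = card (quotient_torsion G g A)"

text \<open>The ratio \<open>|G\<^sub>A| / |k G\<^sub>A|\<close>.\<close>

definition torsion_ratio ::
    "('a, 'b) monoid_scheme \<Rightarrow> ('e \<Rightarrow> 'a) \<Rightarrow> int \<Rightarrow> 'e set \<Rightarrow> rat" where
  "torsion_ratio G g k A =
     of_nat (card (quotient_torsion G g A)) /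
     of_nat (card (multiples (list_quotient G g A) k (quotient_torsion G g A)))"

definition tutte_poly ::
    "('a, 'b) monoid_scheme \<Rightarrow> ('e \<Rightarrow> 'a) \<Rightarrow> 'e set \<Rightarrow> 'r::comm_ring_1 \<Rightarrow> 'r \<Rightarrow> 'r" where
  "tutte_poly G g E x y =
     (\<Sum>A\<in>Pow E. (x - 1) ^ (rk G g E - rk G g A) * (y - 1) ^ (card A - rk G g A))"

definition arith_tutte_poly ::
    "('a, 'b) monoid_scheme \<Rightarrow> ('e \<Rightarrow> 'a) \<Rightarrow> 'e set \<Rightarrow> 'r::comm_ring_1 \<Rightarrow> 'r \<Rightarrow> 'r" where
  "arith_tutte_poly G g E x y =
     (\<Sum>A\<in>Pow E. of_nat (arith_mult G g A) *
        (x - 1) ^ (rk G g E - rk G g A) * (y - 1) ^ (card A - rk G g A))"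

definition tutte_quasi_poly ::
    "('a, 'b) monoid_scheme \<Rightarrow> ('e \<Rightarrow> 'a) \<Rightarrow> 'e set \<Rightarrow> int \<Rightarrow> int \<Rightarrow> rat" where
  "tutte_quasi_poly G g E x y =
     (\<Sum>A\<in>Pow E. torsion_ratio G g ((x - 1) * (y - 1)) A *
        of_int (x - 1) ^ (rk G g E - rk G g A) * of_int (y - 1) ^ (card A - rk G g A))"

text \<open>Homomorphisms are made extensional so that each is counted once.\<close>

definition proper_colorings ::
    "('a, 'b) monoid_scheme \<Rightarrow> ('e \<Rightarrow> 'a) \<Rightarrow> 'e set \<Rightarrow> nat \<Rightarrow> ('a \<Rightarrow> int) set" where
  "proper_colorings G g E q =
     {\<phi> \<in> hom G (integer_mod_group q) \<inter> extensional (carrier G).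
        \<forall>e\<in>E. \<phi> (g e) \<noteq> \<one>\<^bsub>integer_mod_group q\<^esub>}"

definition chi :: "('a, 'b) monoid_scheme \<Rightarrow> ('e \<Rightarrow> 'a) \<Rightarrow> 'e set \<Rightarrow> nat \<Rightarrow> nat" where
  "chi G g E q = card (proper_colorings G g E q)"

text \<open>
  The action of \<open>\<int>/q\<int>\<close> on \<open>G/qG\<close> is computed with the representatives \<open>0, \<dots>, q - 1\<close>
  that form the carrier of \<^const>\<open>integer_mod_group\<close>.
\<close>

definition mod_group :: "('a, 'b) monoid_scheme \<Rightarrow> nat \<Rightarrow> 'a set monoid" where
  "mod_group G q = G Mod multiples G (int q) (carrier G)"

definition nowhere_zero_flows ::
    "('a, 'b) monoid_scheme \<Rightarrow> ('e \<Rightarrow> 'a) \<Rightarrow> 'e set \<Rightarrow> nat \<Rightarrow> ('e \<Rightarrow> int) set" where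
  "nowhere_zero_flows G g E q =
     {\<phi> \<in> E \<rightarrow>\<^sub>E (carrier (integer_mod_group q) - {\<one>\<^bsub>integer_mod_group q\<^esub>}).
        (\<Otimes>\<^bsub>mod_group G q\<^esub>e\<in>E.
            (multiples G (int q) (carrier G) #>\<^bsub>G\<^esub> g e) [^]\<^bsub>mod_group G q\<^esub> \<phi> e)
          = \<one>\<^bsub>mod_group G q\<^esub>}"

definition chi_star :: "('a, 'b) monoid_scheme \<Rightarrow> ('e \<Rightarrow> 'a) \<Rightarrow> 'e set \<Rightarrow> nat \<Rightarrow> nat" where
  "chi_star G g E q = card (nowhere_zero_flows G g E q)"

text \<open>Bases are those of the matroid on \<open>E\<close> with rank function \<open>rk\<close>: maximal independent sets.\<close>

definition indep :: "('a, 'b) monoid_scheme \<Rightarrow> ('e \<Rightarrow> 'a) \<Rightarrow> 'e set \<Rightarrow> 'e set \<Rightarrow> bool" where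
  "indep G g E A \<longleftrightarrow> A \<subseteq> E \<and> rk G g A = card A"

definition bases :: "('a, 'b) monoid_scheme \<Rightarrow> ('e \<Rightarrow> 'a) \<Rightarrow> 'e set \<Rightarrow> 'e set set" where
  "bases G g E = {B. indep G g E B \<and> (\<forall>A. indep G g E A \<and> B \<subseteq> A \<longrightarrow> A = B)}"

definition Z_M :: "('a, 'b) monoid_scheme \<Rightarrow> ('e \<Rightarrow> 'a) \<Rightarrow> 'e set \<Rightarrow> nat set" where
  "Z_M G g E = {q. q > 0 \<and> gcd q (Lcm (arith_mult G g ` bases G g E)) = 1}"

definition Z_A :: "('a, 'b) monoid_scheme \<Rightarrow> ('e \<Rightarrow> 'a) \<Rightarrow> 'e set \<Rightarrow> nat set" where
  "Z_A G g E = {q. q > 0 \<and> (\<forall>B\<in>bases G g E.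
     multiples (list_quotient G g B) (int q) (quotient_torsion G g B)
       = {\<one>\<^bsub>list_quotient G g B\<^esub>})}"

end

(*
  By inclusion-exclusion, chi and chi* are alternating sums over A of the number of homomorphisms
  G -> Z/q that vanish on L_A, and of the number of flows supported in A. Homomorphisms that vanish
  on L_A are homomorphisms on the finite group H/qH, where H = G/<L_A>; its exponent divides q, so
  there are |H/qH| of them. The flows supported in A are the kernel of the map (Z/q)^A -> G/qG,
  whose image has index |H/qH|. Both counts thus come down to
    |H/qH| = q^(rk H) * |{x in H. q x = 0}| = q^(rk H) * |T| / |q T|, where T is the torsion of H.
  For the first equality take F <= H generated by a maximal independent set: the finite group
  Q = H/qF satisfies |Q/qQ| = |{x in Q. q x = 0}|, the left side is |H/qH|, and the right side counts
  pairs in F/qF and {x in H. q x = 0}. With q = 2 the formula also shows that all maximal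
  independent sets have the same size.

  For the special values of q, every A has a basis B such that the torsion of G/<L_A> is a
  subquotient of that of G/<L_B>.
*)

theory Submission
  imports Defs
begin

section \<open>Integer combinations and independence\<close>

text \<open>No decomposition into cyclic groups is used, and linear algebra over the rationals is
  replaced by \<open>rad\<close>: an element depends on S when some positive power of it lies in
  \<open>generate G S\<close>. The obstacle is that \<open>abelian_rank\<close> is a maximum of
  cardinalities, so a single maximal independent set computes it only once all of them are known to
  be equally large. In place of an exchange argument this is read off from |G/qG|, which does not
  know about the chosen set. The equality |Q/qQ| = |Q[q]| is image against kernel of multiplication
  by q, which is available only for finite Q. The group H may be infinite, and dividing by qF is the
  smallest change that makes it finite and still leaves H/qH visible as a quotient. In the flow
  count the ratio |T| / |qT| belonging to A is divided by the one belonging to the empty set,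
  because the relations live in G/qG, whose own size contains the latter.\<close>

definition (in comm_group) comb :: "'a set \<Rightarrow> ('a \<Rightarrow> int) \<Rightarrow> 'a" where
  "comb S c = (\<Otimes>s\<in>S. s [^] c s)"

text \<open>For a subgroup K this is the preimage in G of the torsion of G/K, that is, the elements
  that vanish in (G/K) tensored with the rationals.\<close>

definition (in group) rad :: "'a set \<Rightarrow> 'a set" where
  "rad K = {x \<in> carrier G. \<exists>n::nat. n > 0 \<and> x [^] n \<in> K}"

context comm_group
begin

lemma comb_closed [simp]: "S \<subseteq> carrier G \<Longrightarrow> comb S c \<in> carrier G"
  unfolding comb_def by (rule finprod_closed) auto

lemma comb_add:
  assumes "S \<subseteq> carrier G"
  shows "comb S (\<lambda>s. c s + d s) = comb S c \<otimes> comb S d"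
proof -
  have "comb S (\<lambda>s. c s + d s) = (\<Otimes>s\<in>S. s [^] c s \<otimes> s [^] d s)"
    unfolding comb_def using assms by (intro finprod_cong') (auto intro: int_pow_mult)
  also have "\<dots> = comb S c \<otimes> comb S d"
    unfolding comb_def using assms by (intro finprod_multf) auto
  finally show ?thesis .
qed

lemma comb_zero [simp]: "comb S (\<lambda>s. 0) = \<one>"
  unfolding comb_def by simp

lemma comb_cong: "S \<subseteq> carrier G \<Longrightarrow> (\<And>s. s \<in> S \<Longrightarrow> c s = d s) \<Longrightarrow> comb S c = comb S d"
  unfolding comb_def by (rule finprod_cong') auto

lemma comb_uminus: "S \<subseteq> carrier G \<Longrightarrow> comb S (\<lambda>s. - c s) = inv (comb S c)"
  using comb_add [of S "\<lambda>s. - c s" c] by (intro inv_equality [symmetric]) auto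

lemma comb_diff:
  "S \<subseteq> carrier G \<Longrightarrow> comb S (\<lambda>s. c s - d s) = comb S c \<otimes> inv (comb S d)"
  using comb_add [of S c "\<lambda>s. - d s"] by (simp add: comb_uminus)

lemma comb_insert:
  "finite S \<Longrightarrow> x \<notin> S \<Longrightarrow> insert x S \<subseteq> carrier G \<Longrightarrow>
   comb (insert x S) c = x [^] c x \<otimes> comb S c"
  unfolding comb_def by (subst finprod_insert) (auto simp: subset_iff Pi_iff)

lemma comb_pow:
  fixes k :: int
  assumes "S \<subseteq> carrier G"
  shows "comb S c [^] k = comb S (\<lambda>s. k * c s)"
  using assms
proof (induction S rule: infinite_finite_induct)
  case (insert x S)
  then have "comb (insert x S) c [^] k = (x [^] c x) [^] k \<otimes> comb S c [^] k"
    by (simp add: comb_insert int_pow_distrib)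
  also have "\<dots> = x [^] (k * c x) \<otimes> comb S (\<lambda>s. k * c s)"
    using insert by (simp add: int_pow_pow mult.commute)
  also have "\<dots> = comb (insert x S) (\<lambda>s. k * c s)"
    using insert by (simp add: comb_insert)
  finally show ?case .
qed (auto simp: comb_def)

lemma comb_nat_pow:
  fixes k :: nat
  shows "S \<subseteq> carrier G \<Longrightarrow> comb S c [^] k = comb S (\<lambda>s. int k * c s)"
  using comb_pow [of S c "int k"] by (simp add: int_pow_int)

lemma comb_single:
  assumes "finite S" "S \<subseteq> carrier G" "x \<in> S"
  shows "comb S (\<lambda>s. if s = x then k else 0) = x [^] k"
proof -
  have "comb (insert x (S - {x})) (\<lambda>s. if s = x then k else 0)
      = x [^] k \<otimes> comb (S - {x}) (\<lambda>s. if s = x then k else 0)"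
    using assms by (subst comb_insert) auto
  also have "comb (S - {x}) (\<lambda>s. if s = x then k else 0) = comb (S - {x}) (\<lambda>s. 0)"
    using assms by (intro comb_cong) auto
  finally show ?thesis using assms by (auto simp: insert_absorb)
qed

lemma comb_extend:
  assumes "finite T" "T \<subseteq> carrier G" "S \<subseteq> T" "\<And>s. s \<in> T - S \<Longrightarrow> c s = 0"
  shows "comb T c = comb S c"
  unfolding comb_def
  using assms by (intro finprod_mono_neutral_cong_right) auto

lemma finprod_in_subgroup:
  assumes "subgroup K G" "f \<in> A \<rightarrow> K"
  shows "finprod G f A \<in> K"
  using assms(2)
proof (induction A rule: infinite_finite_induct)
  case (insert x A)
  then show ?case using subgroup.subset [OF assms(1)]
    by (subst finprod_insert) (auto simp: Pi_iff intro: subgroup.m_closed [OF assms(1)])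
qed (use subgroup.one_closed [OF assms(1)] in auto)

lemma comb_in_subgroup:
  assumes "subgroup K G" "S \<subseteq> K"
  shows "comb S c \<in> K"
  unfolding comb_def using assms by (auto intro!: finprod_in_subgroup subgroup_int_pow_closed)

lemma generate_eq_range_comb:
  assumes "finite S" "S \<subseteq> carrier G"
  shows "generate G S = range (comb S)"
proof (rule generateI [symmetric])
  show "subgroup (range (comb S)) G"
  proof (rule subgroupI)
    show "inv a \<in> range (comb S)" if "a \<in> range (comb S)" for a
      using that assms by (auto simp flip: comb_uminus)
    show "a \<otimes> b \<in> range (comb S)" if "a \<in> range (comb S)" "b \<in> range (comb S)" for a b
      using that assms by (auto simp flip: comb_add)
  qed (use assms in auto)
  show "S \<subseteq> range (comb S)"
  proof
    fix x assume "x \<in> S"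
    with assms have "x = comb S (\<lambda>s. if s = x then 1 else 0)"
      by (subst comb_single) auto
    then show "x \<in> range (comb S)" by blast
  qed
  show "range (comb S) \<subseteq> K" if "subgroup K G" "S \<subseteq> K" for K
    using comb_in_subgroup [OF that] by blast
qed

lemma int_independent_iff:
  "int_independent G S \<longleftrightarrow> finite S \<and> S \<subseteq> carrier G \<and>
     (\<forall>c. comb S c = \<one> \<longrightarrow> (\<forall>s\<in>S. c s = 0))"
  unfolding int_independent_def comb_def ..

lemma comb_eqD:
  assumes "int_independent G S" "comb S c = comb S d" "s \<in> S"
  shows "c s = d s"
proof -
  have "S \<subseteq> carrier G" using assms(1) by (simp add: int_independent_iff)
  with assms(2) have "comb S (\<lambda>s. c s - d s) = \<one>"
    by (subst comb_diff) (auto)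
  with assms(1,3) show ?thesis
    unfolding int_independent_iff by fastforce
qed

lemma subgroup_nat_pow_closed: "subgroup K G \<Longrightarrow> x \<in> K \<Longrightarrow> x [^] (n::nat) \<in> K"
  using subgroup_int_pow_closed [of K x "int n"] by (simp add: int_pow_int)

section \<open>Radicals of subgroups and maximal independent sets\<close>

lemma subgroup_rad:
  assumes K: "subgroup K G"
  shows "subgroup (rad K) G"
proof (rule subgroupI)
  show "rad K \<noteq> {}"
    using subgroup.one_closed [OF K] by (auto simp: rad_def intro!: exI [of _ "\<one>"] exI [of _ 1])
  fix a assume a: "a \<in> rad K"
  then obtain n :: nat where n: "n > 0" "a [^] n \<in> K" and ac: "a \<in> carrier G"
    by (auto simp: rad_def)
  show "inv a \<in> rad K"
    using n ac by (auto simp: rad_def nat_pow_inv intro!: exI [of _ n] subgroup.m_inv_closed [OF K])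
  fix b assume "b \<in> rad K"
  then obtain m :: nat where m: "m > 0" "b [^] m \<in> K" and bc: "b \<in> carrier G"
    by (auto simp: rad_def)
  have "(a \<otimes> b) [^] (n * m) = (a [^] n) [^] m \<otimes> (b [^] m) [^] n"
    using ac bc by (simp add: nat_pow_distrib nat_pow_pow mult.commute)
  also have "\<dots> \<in> K"
    using n m by (simp add: subgroup.m_closed [OF K] subgroup_nat_pow_closed [OF K])
  finally show "a \<otimes> b \<in> rad K"
    using n m ac bc by (auto simp: rad_def intro!: exI [of _ "n * m"])
qed (auto simp: rad_def)

lemma subgroup_le_rad: "K \<subseteq> carrier G \<Longrightarrow> K \<subseteq> rad K"
  by (auto simp: rad_def subset_iff intro!: exI [of _ 1])

lemma rad_mono: "K \<subseteq> L \<Longrightarrow> rad K \<subseteq> rad L"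
  by (auto simp: rad_def)

lemma rad_rad: "rad (rad K) \<subseteq> rad K"
proof
  fix x assume "x \<in> rad (rad K)"
  then obtain n m :: nat where "x \<in> carrier G" "n > 0" "m > 0" "(x [^] n) [^] m \<in> K"
    by (auto simp: rad_def)
  then show "x \<in> rad K"
    by (auto simp: rad_def nat_pow_pow intro!: exI [of _ "n * m"])
qed

lemma generate_le_rad:
  assumes "subgroup K G" "U \<subseteq> rad K"
  shows "generate G U \<subseteq> rad K"
  using generate_subgroup_incl [OF assms(2) subgroup_rad [OF assms(1)]] .

text \<open>Some power n > 0 of the combination is a combination of A alone, and uniqueness of
  coefficients gives \<open>n * c s = 0\<close> off A. For A empty this says that an independent set
  spans a torsion-free group. It also controls ranks of quotients and, later, the choice of
  bases.\<close>

lemma comb_coeff_eq_zero: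
  assumes "int_independent G S" "A \<subseteq> S" "comb S c \<in> rad (generate G A)" "s \<in> S - A"
  shows "c s = 0"
proof -
  from assms(1,2) have S: "finite S" "S \<subseteq> carrier G" and A: "finite A" "A \<subseteq> carrier G"
    by (auto simp: int_independent_iff intro: finite_subset)
  from assms(3) obtain n :: nat and d where n: "n > 0" and d: "comb S c [^] n = comb A d"
    by (auto simp: rad_def generate_eq_range_comb [OF A])
  have "comb A d = comb A (\<lambda>s. if s \<in> A then d s else 0)"
    using A by (intro comb_cong) auto
  also have "\<dots> = comb S (\<lambda>s. if s \<in> A then d s else 0)"
    using S assms(2) by (intro comb_extend [symmetric]) auto
  finally have "comb S (\<lambda>s. int n * c s) = comb S (\<lambda>s. if s \<in> A then d s else 0)"
    using d S by (simp add: comb_nat_pow)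
  from comb_eqD [OF assms(1) this, of s] assms(4) n show ?thesis by auto
qed

text \<open>Take T maximal among the finitely many independent sets between S and
  \<open>S \<union> U\<close>. Adjoining an x from U outside T creates a relation; its coefficient
  at x is nonzero, for otherwise it would be a relation on T.\<close>

lemma exists_independent_extension:
  assumes "int_independent G S" "finite U" "U \<subseteq> carrier G"
  obtains T where "S \<subseteq> T" "T \<subseteq> S \<union> U" "int_independent G T" "U \<subseteq> rad (generate G T)"
proof -
  define F where "F = {T. S \<subseteq> T \<and> T \<subseteq> S \<union> U \<and> int_independent G T}"
  have S: "finite S" "S \<subseteq> carrier G" using assms(1) by (auto simp: int_independent_iff)
  have "finite F"
    by (rule finite_subset [of _ "Pow (S \<union> U)"]) (use S assms in \<open>auto simp: F_def\<close>)
  moreover have "S \<in> F" using assms by (auto simp: F_def)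
  ultimately obtain T where T: "T \<in> F" and max: "\<And>T'. T' \<in> F \<Longrightarrow> T \<subseteq> T' \<Longrightarrow> T' = T"
    using finite_has_maximal [of F] by (metis empty_iff)
  have Ti: "int_independent G T" and Tc: "T \<subseteq> carrier G" "finite T"
    using T by (auto simp: F_def int_independent_iff)
  have sub: "subgroup (generate G T) G" using Tc by (simp add: generate_is_subgroup)
  have "x \<in> rad (generate G T)" if x: "x \<in> U" for x
  proof (cases "x \<in> T")
    case True
    then have "x \<in> generate G T" by (rule generate.incl)
    then show ?thesis using subgroup_le_rad [of "generate G T"] subgroup.subset [OF sub] by blast
  next
    case False
    have "\<not> int_independent G (insert x T)"
      using max [of "insert x T"] T x False by (auto simp: F_def)
    then obtain c where c: "comb (insert x T) c = \<one>" and nz: "\<exists>s\<in>insert x T. c s \<noteq> 0"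
      using Tc x assms(3) by (auto simp: int_independent_iff)
    have xc: "x \<in> carrier G" using x assms by auto
    have eq: "x [^] c x \<otimes> comb T c = \<one>"
      using c False Tc xc by (simp add: comb_insert)
    have "c x \<noteq> 0"
    proof
      assume "c x = 0"
      with eq Tc have "comb T c = \<one>" by simp
      with Ti nz \<open>c x = 0\<close> show False by (auto simp: int_independent_iff)
    qed
    have p: "x [^] c x = comb T (\<lambda>s. - c s)"
      using eq Tc xc by (simp add: comb_uminus inv_equality [symmetric])
    then have m: "x [^] c x \<in> generate G T" "x [^] (- c x) \<in> generate G T"
      using Tc xc by (auto simp: generate_eq_range_comb int_pow_neg comb_uminus [symmetric])
    \<comment> \<open>\<open>rad\<close> asks for a positive natural exponent, while the coefficient
      of the relation may have either sign.\<close>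
    have "x [^] nat \<bar>c x\<bar> \<in> generate G T"
      using m by (cases "c x \<ge> 0") (auto simp: pow_nat)
    then show ?thesis using xc \<open>c x \<noteq> 0\<close> by (auto simp: rad_def intro!: exI [of _ "nat \<bar>c x\<bar>"])
  qed
  with T Ti that show thesis by (auto simp: F_def)
qed

lemma int_independent_empty [simp]: "int_independent G {}"
  by (simp add: int_independent_iff)

text \<open>Each coefficient may be reduced modulo an exponent of its generator, which leaves
  finitely many combinations.\<close>

lemma finite_torsion_generate:
  assumes "finite U" "U \<subseteq> carrier G" "\<And>x. x \<in> U \<Longrightarrow> \<exists>n::nat. n > 0 \<and> x [^] n = \<one>"
  shows "finite (generate G U)"
proof -
  obtain n :: "'a \<Rightarrow> nat" where n: "\<And>x. x \<in> U \<Longrightarrow> n x > 0 \<and> x [^] n x = \<one>"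
    using assms(3) by metis
  have "range (comb U) \<subseteq> comb U ` (\<Pi>\<^sub>E x\<in>U. {0..<int (n x)})"
  proof
    fix y assume "y \<in> range (comb U)"
    then obtain c where y: "y = comb U c" by blast
    have "x [^] c x = x [^] (c x mod int (n x))" if "x \<in> U" for x
    proof -
      have xc: "x \<in> carrier G" using that assms by auto
      have "x [^] (c x mod int (n x) + int (n x) * (c x div int (n x)))
          = x [^] (c x mod int (n x)) \<otimes> (x [^] int (n x)) [^] (c x div int (n x))"
        using xc by (simp only: int_pow_mult int_pow_pow)
      then show ?thesis using n [OF that] xc by (simp add: int_pow_int)
    qed
    then have "y = comb U (\<lambda>x\<in>U. c x mod int (n x))"
      unfolding y comb_def using assms(2) by (intro finprod_cong') auto
    moreover have "(\<lambda>x\<in>U. c x mod int (n x)) \<in> (\<Pi>\<^sub>E x\<in>U. {0..<int (n x)})"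
      using n by auto
    ultimately show "y \<in> comb U ` (\<Pi>\<^sub>E x\<in>U. {0..<int (n x)})" by blast
  qed
  moreover have "finite (\<Pi>\<^sub>E x\<in>U. {0..<int (n x)})"
    using assms(1) by (intro finite_PiE) auto
  ultimately show ?thesis
    using generate_eq_range_comb [OF assms(1,2)] finite_surj by metis
qed

end

section \<open>Multiples, torsion and rank\<close>

lemma card_image_cong_inj:
  assumes "\<And>x y. x \<in> A \<Longrightarrow> y \<in> A \<Longrightarrow> f x = f y \<longleftrightarrow> h x = h y"
  shows "card (f ` A) = card (h ` A)"
proof (rule bij_betw_same_card)
  let ?r = "\<lambda>z. h (inv_into A f z)"
  have r: "?r (f x) = h x" if "x \<in> A" for x
    using assms that f_inv_into_f [of "f x" f A] inv_into_into [of "f x" f A] by blast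
  show "bij_betw ?r (f ` A) (h ` A)"
    unfolding bij_betw_def inj_on_def using assms by (auto simp: r image_iff)
qed

context comm_group
begin

section \<open>Cosets and counting in quotients\<close>

lemma rcos_eq_iff:
  assumes "subgroup K G" "x \<in> carrier G" "y \<in> carrier G"
  shows "K #> x = K #> y \<longleftrightarrow> x \<otimes> inv y \<in> K"
proof
  assume "K #> x = K #> y"
  then have "x \<in> K #> y" using rcos_self [OF assms(2,1)] by simp
  then show "x \<otimes> inv y \<in> K"
    using subgroup.rcos_module [OF assms(1) is_group assms(3,2)] by simp
next
  assume "x \<otimes> inv y \<in> K"
  then have "x \<in> K #> y"
    using subgroup.rcos_module [OF assms(1) is_group assms(3,2)] by simp
  then show "K #> x = K #> y"
    using repr_independence [of x K y] assms by simp
qed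

lemma rcos_eq_self_iff:
  assumes "subgroup K G" "x \<in> carrier G"
  shows "K #> x = K \<longleftrightarrow> x \<in> K"
  using coset_join2 [OF assms(2,1)] rcos_self [OF assms(2,1)] by auto

lemma comm_group_Mod: "subgroup K G \<Longrightarrow> comm_group (G Mod K)"
  by (rule abelian_FactGroup)

lemma rcos_hom: "subgroup K G \<Longrightarrow> (\<lambda>x. K #> x) \<in> hom G (G Mod K)"
  by (rule normal.r_coset_hom_Mod) (rule subgroup_imp_normal)

lemma rcos_group_hom: "subgroup K G \<Longrightarrow> group_hom G (G Mod K) (\<lambda>x. K #> x)"
  by (intro group_hom.intro group_hom_axioms.intro is_group rcos_hom comm_group.axioms(2)
        comm_group_Mod)

lemma Mod_nat_pow:
  "subgroup K G \<Longrightarrow> x \<in> carrier G \<Longrightarrow> (K #> x) [^]\<^bsub>G Mod K\<^esub> (n::nat) = K #> (x [^] n)"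
  by (rule normal.FactGroup_pow) (rule subgroup_imp_normal)

lemma Mod_int_pow:
  "subgroup K G \<Longrightarrow> x \<in> carrier G \<Longrightarrow> (K #> x) [^]\<^bsub>G Mod K\<^esub> (n::int) = K #> (x [^] n)"
  by (rule normal.FactGroup_int_pow) (rule subgroup_imp_normal)

lemma pow_hom: "(\<lambda>x. x [^] (k::int)) \<in> hom G G"
  by (rule homI) (auto simp: int_pow_distrib)

lemma subgroup_multiples: "subgroup K G \<Longrightarrow> subgroup (multiples G k K) G"
proof -
  interpret group_hom G G "\<lambda>x. x [^] k"
    by (intro group_hom.intro group_hom_axioms.intro is_group pow_hom)
  show "subgroup K G \<Longrightarrow> ?thesis" unfolding multiples_def by (rule subgroup_img_is_subgroup)
qed

end

lemma (in group_hom) eq_iff_diff_kernel: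
  assumes "x \<in> carrier G" "y \<in> carrier G"
  shows "h x = h y \<longleftrightarrow> h (x \<otimes> inv y) = \<one>\<^bsub>H\<^esub>"
  using assms H.inv_solve_right' [of "\<one>\<^bsub>H\<^esub>" "h x" "h y"] by auto

lemma (in group_hom) card_image_kernel:
  assumes "finite (carrier G)"
  shows "card (carrier G) = card (h ` carrier G) * card {x \<in> carrier G. h x = \<one>\<^bsub>H\<^esub>}"
proof -
  let ?K = "{x \<in> carrier G. h x = \<one>\<^bsub>H\<^esub>}"
  have K: "subgroup ?K G" using subgroup_kernel by (simp add: kernel_def)
  have "card (rcosets ?K) = card ((\<lambda>x. ?K #> x) ` carrier G)"
    by (rule arg_cong [of _ _ card]) (auto simp: RCOSETS_def)
  also have "\<dots> = card (h ` carrier G)"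
  proof (rule card_image_cong_inj)
    fix x y assume xy: "x \<in> carrier G" "y \<in> carrier G"
    show "?K #> x = ?K #> y \<longleftrightarrow> h x = h y"
    proof
      assume "?K #> x = ?K #> y"
      then have "x \<in> ?K #> y" using G.rcos_self [OF xy(1) K] by simp
      then have "x \<otimes> inv y \<in> ?K" using subgroup.rcos_module [OF K G.is_group xy(2,1)] by simp
      then show "h x = h y" using eq_iff_diff_kernel [OF xy] by simp
    next
      assume "h x = h y"
      then have "x \<otimes> inv y \<in> ?K" using eq_iff_diff_kernel [OF xy] xy by simp
      then have "x \<in> ?K #> y" using subgroup.rcos_module [OF K G.is_group xy(2,1)] by simp
      then show "?K #> x = ?K #> y" using G.repr_independence [of x ?K y] K xy by simp
    qed
  qed
  finally show ?thesis using G.lagrange [OF K] by (simp add: order_def)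
qed

context comm_group
begin

text \<open>The map f kills K and so descends to \<open>G Mod K\<close>, where image times kernel is
  counted. The result speaks only of f on G, and only the quotient has to be finite; this matters
  because G is usually infinite.\<close>

lemma card_Mod_image_kernel:
  assumes K: "subgroup K G" and B: "group B" and f: "f \<in> hom G B"
    and ker: "\<And>x. x \<in> K \<Longrightarrow> f x = \<one>\<^bsub>B\<^esub>" and fin: "finite (carrier (G Mod K))"
  shows "card (carrier (G Mod K)) =
    card (f ` carrier G) * card ((\<lambda>x. K #> x) ` {x \<in> carrier G. f x = \<one>\<^bsub>B\<^esub>})"
proof -
  interpret f: group_hom G B f
    by (intro group_hom.intro group_hom_axioms.intro is_group B f)
  have "f x = f y" if "x \<in> carrier G" "y \<in> carrier G" "K #> x = K #> y" for x y
    using that ker rcos_eq_iff [OF K] f.eq_iff_diff_kernel by blast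
  from FactGroup_universal [OF f subgroup_imp_normal [OF K] this]
  obtain u where u: "u \<in> hom (G Mod K) B" and uf: "\<And>x. x \<in> carrier G \<Longrightarrow> u (K #> x) = f x"
    by blast
  interpret u: group_hom "G Mod K" B u
    by (intro group_hom.intro group_hom_axioms.intro comm_group.axioms(2) comm_group_Mod K B u)
  have "u ` carrier (G Mod K) = f ` carrier G"
    by (auto simp: carrier_FactGroup uf image_image)
  moreover have "{x \<in> carrier (G Mod K). u x = \<one>\<^bsub>B\<^esub>}
      = (\<lambda>x. K #> x) ` {x \<in> carrier G. f x = \<one>\<^bsub>B\<^esub>}"
    by (auto simp: carrier_FactGroup uf)
  ultimately show ?thesis using u.card_image_kernel [OF fin] by simp
qed

text \<open>Multiplicativity of the index. L/K appears as the set of cosets of K met by L, which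
  lies inside \<open>G Mod K\<close> and avoids a second group structure.\<close>

lemma card_Mod_tower:
  assumes K: "subgroup K G" and L: "subgroup L G" and "K \<subseteq> L"
    and fin: "finite (carrier (G Mod K))"
  shows "card (carrier (G Mod K)) = card (carrier (G Mod L)) * card ((\<lambda>x. K #> x) ` L)"
proof -
  have "{x \<in> carrier G. L #> x = \<one>\<^bsub>G Mod L\<^esub>} = L"
    using subgroup.subset [OF L] rcos_eq_self_iff [OF L] by auto
  then show ?thesis
    using card_Mod_image_kernel [OF K comm_group.axioms(2) [OF comm_group_Mod [OF L]]
        rcos_hom [OF L] _ fin] \<open>K \<subseteq> L\<close> rcos_eq_self_iff [OF L] subgroup.subset [OF L]
    by (auto simp: carrier_FactGroup subset_iff)
qed

lemma generate_Mod:
  assumes "subgroup K G" "U \<subseteq> carrier G" "generate G U = carrier G"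
  shows "generate (G Mod K) ((\<lambda>x. K #> x) ` U) = carrier (G Mod K)"
  using group_hom.generate_img [OF rcos_group_hom [OF assms(1)] assms(2)] assms(3)
  by (simp add: carrier_FactGroup)

text \<open>The generators of G become torsion elements modulo K.\<close>

lemma finite_Mod:
  assumes K: "subgroup K G" and U: "finite U" "U \<subseteq> carrier G" "generate G U = carrier G"
    and rad: "U \<subseteq> rad K"
  shows "finite (carrier (G Mod K))"
proof -
  have "\<exists>n::nat. n > 0 \<and> y [^]\<^bsub>G Mod K\<^esub> n = \<one>\<^bsub>G Mod K\<^esub>" if "y \<in> (\<lambda>x. K #> x) ` U" for y
  proof -
    from that obtain x where x: "y = K #> x" "x \<in> U" by blast
    with rad obtain n :: nat where "n > 0" "x [^] n \<in> K" by (auto simp: rad_def)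
    then show ?thesis
      using x U by (intro exI [of _ n]) (auto simp: Mod_nat_pow K rcos_eq_self_iff subset_iff)
  qed
  then have "finite (generate (G Mod K) ((\<lambda>x. K #> x) ` U))"
    using U by (intro comm_group.finite_torsion_generate comm_group_Mod K)
               (auto simp: carrier_FactGroup)
  then show ?thesis by (simp add: generate_Mod K U)
qed

section \<open>The torsion subgroup and the order of G/qG\<close>

lemma torsion_set_eq_rad: "torsion_set G = rad {\<one>}"
  by (auto simp: torsion_set_def rad_def)

lemma subgroup_torsion_set: "subgroup (torsion_set G) G"
  unfolding torsion_set_eq_rad by (rule subgroup_rad) (rule triv_subgroup)

lemma torsion_in_generate_independent:
  assumes "int_independent G S" "x \<in> generate G S" "x \<in> torsion_set G"
  shows "x = \<one>"
proof -
  have S: "finite S" "S \<subseteq> carrier G" using assms(1) by (auto simp: int_independent_iff)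
  obtain c where c: "x = comb S c" using assms(2) S by (auto simp: generate_eq_range_comb)
  have "comb S c \<in> rad (generate G {})"
    using assms(3) c by (simp add: torsion_set_eq_rad generate_empty)
  then have "c s = 0" if "s \<in> S" for s
    using comb_coeff_eq_zero [OF assms(1) _ _, of "{}" c s] that by simp
  then have "comb S c = comb S (\<lambda>s. 0)" using S by (intro comb_cong) auto
  then show ?thesis using c by simp
qed

text \<open>For a maximal independent S the span of S is torsion-free, so the torsion of G embeds
  into the quotient by that span, which is finite.\<close>

lemma finite_torsion_set:
  assumes U: "finite U" "U \<subseteq> carrier G" "generate G U = carrier G"
  shows "finite (torsion_set G)"
proof -
  obtain S where S: "int_independent G S" "U \<subseteq> rad (generate G S)"
    using exists_independent_extension [OF int_independent_empty U(1,2)] by metis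
  have sub: "subgroup (generate G S) G"
    using S(1) by (auto simp: int_independent_iff intro: generate_is_subgroup)
  have T: "subgroup (torsion_set G) G" by (rule subgroup_torsion_set)
  have "inj_on (\<lambda>x. generate G S #> x) (torsion_set G)"
  proof (rule inj_onI)
    fix x y assume xy: "x \<in> torsion_set G" "y \<in> torsion_set G"
      and eq: "generate G S #> x = generate G S #> y"
    then have c: "x \<in> carrier G" "y \<in> carrier G" by (auto simp: torsion_set_def)
    have "x \<otimes> inv y \<in> torsion_set G"
      using xy by (intro subgroup.m_closed [OF T] subgroup.m_inv_closed [OF T])
    with eq c have "x \<otimes> inv y = \<one>"
      using torsion_in_generate_independent [OF S(1)] rcos_eq_iff [OF sub] by blast
    with c show "x = y" by (metis inv_closed inv_equality inv_inv)
  qed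
  moreover have "(\<lambda>x. generate G S #> x) ` torsion_set G \<subseteq> carrier (G Mod generate G S)"
    by (auto simp: carrier_FactGroup torsion_set_def)
  ultimately show ?thesis
    using finite_Mod [OF sub U S(2)] inj_on_finite by blast
qed

text \<open>Every solution of \<open>x [^] q = \<one>\<close> is torsion, so the kernel of the q-th
  power on the torsion subgroup is all of G[q]. This turns the ratio |T| / |qT| into an integer
  count.\<close>

lemma card_torsion_multiples:
  assumes fin: "finite (torsion_set G)" and "q > 0"
  shows "card (torsion_set G) =
    card (multiples G (int q) (torsion_set G)) * card {x \<in> carrier G. x [^] q = \<one>}"
proof -
  let ?T = "G\<lparr>carrier := torsion_set G\<rparr>"
  interpret T: group_hom ?T G "\<lambda>x. x [^] int q"
    using subgroup_torsion_set subgroup.subset [OF subgroup_torsion_set]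
    by (auto intro!: group_hom.intro group_hom_axioms.intro is_group homI subgroup_imp_group
          int_pow_distrib)
  have "{x \<in> torsion_set G. x [^] q = \<one>} = {x \<in> carrier G. x [^] q = \<one>}"
    using \<open>q > 0\<close> by (auto simp: torsion_set_def)
  then show ?thesis
    using T.card_image_kernel fin by (simp add: multiples_def int_pow_int)
qed

lemma card_Mod_multiples:
  assumes U: "finite U" "U \<subseteq> carrier G" "generate G U = carrier G"
    and S: "int_independent G S" "U \<subseteq> rad (generate G S)" and q: "q > 0"
  shows "card (carrier (G Mod multiples G (int q) (carrier G))) =
     q ^ card S * card {x \<in> carrier G. x [^] q = \<one>}"
proof -
  let ?F = "generate G S" and ?mG = "multiples G (int q) (carrier G)"
  let ?tors = "{x \<in> carrier G. x [^] q = \<one>}"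
  define P where "P = multiples G (int q) ?F"
  have Sc: "finite S" "S \<subseteq> carrier G" using S(1) by (auto simp: int_independent_iff)
  have F: "subgroup ?F G" using Sc by (simp add: generate_is_subgroup)
  have P: "subgroup P G" unfolding P_def by (rule subgroup_multiples [OF F])
  have mG: "subgroup ?mG G" by (rule subgroup_multiples [OF subgroup_self])
  have "P \<subseteq> ?mG" using subgroup.subset [OF F] by (auto simp: P_def multiples_def)
  \<comment> \<open>F and P = qF have the same radical, since a further q-th power leads from F into
    P. Hence \<open>G Mod P\<close> is finite too.\<close>
  have "rad ?F \<subseteq> rad P"
  proof
    fix x assume "x \<in> rad ?F"
    then obtain n :: nat where n: "x \<in> carrier G" "n > 0" "x [^] n \<in> ?F" by (auto simp: rad_def)
    then have "(x [^] n) [^] int q \<in> P" unfolding P_def multiples_def by blast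
    then show "x \<in> rad P"
      using n q by (auto simp: rad_def int_pow_int nat_pow_pow intro!: exI [of _ "n * q"])
  qed
  with S(2) have "U \<subseteq> rad P" by blast
  then have fin: "finite (carrier (G Mod P))" by (rule finite_Mod [OF P U])
  have Pmem: "x \<in> P \<longleftrightarrow> (\<exists>c. x = comb S (\<lambda>s. int q * c s))" for x
    using Sc by (simp add: P_def multiples_def generate_eq_range_comb image_iff comb_pow)
  have hom: "(\<lambda>x. P #> (x [^] int q)) \<in> hom G (G Mod P)"
    using Group.hom_compose [OF pow_hom [of "int q"] rcos_hom [OF P]] by (simp add: comp_def)
  let ?D = "{x \<in> carrier G. x [^] int q \<in> P}"
  have D: "{x \<in> carrier G. P #> (x [^] int q) = \<one>\<^bsub>G Mod P\<^esub>} = ?D"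
    using rcos_eq_self_iff [OF P] by auto
  have "(\<lambda>x. P #> (x [^] int q)) ` carrier G = (\<lambda>x. P #> x) ` ?mG"
    by (auto simp: multiples_def)
  \<comment> \<open>Multiplication by q on Q = G/P has image qG/P, and its kernel Q[q] is the image
    of \<open>?D\<close>. The projection from G/P to G/qG has kernel qG/P as well. Cancelling |qG/P|
    from the two factorisations of |Q| leaves |G/qG| = |Q[q]|.\<close>
  then have "card (carrier (G Mod P)) = card ((\<lambda>x. P #> x) ` ?mG) * card ((\<lambda>x. P #> x) ` ?D)"
    using card_Mod_image_kernel [OF P comm_group.axioms(2) [OF comm_group_Mod [OF P]] hom _ fin] D
      rcos_eq_self_iff [OF P] subgroup_int_pow_closed [OF P] subgroup.subset [OF P]
    by (auto simp: subset_iff)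
  moreover have "card (carrier (G Mod P)) = card (carrier (G Mod ?mG)) * card ((\<lambda>x. P #> x) ` ?mG)"
    by (rule card_Mod_tower [OF P mG \<open>P \<subseteq> ?mG\<close> fin])
  moreover have "finite ((\<lambda>x. P #> x) ` ?mG)"
    using fin finite_subset [of "(\<lambda>x. P #> x) ` ?mG" "carrier (G Mod P)"]
      subgroup.subset [OF mG] by (auto simp: carrier_FactGroup)
  then have "card ((\<lambda>x. P #> x) ` ?mG) > 0"
    using subgroup.one_closed [OF mG] by (auto simp: card_gt_0_iff)
  ultimately have main: "card (carrier (G Mod ?mG)) = card ((\<lambda>x. P #> x) ` ?D)"
    by simp
  \<comment> \<open>Elements of Q[q] are written uniquely as a combination of S with coefficients
    modulo q times an element of G[q]. This is where the factor \<open>q ^ card S\<close>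
    arises.\<close>
  have "bij_betw (\<lambda>(c, t). P #> (comb S c \<otimes> t)) ((\<Pi>\<^sub>E s\<in>S. {0..<int q}) \<times> ?tors) ((\<lambda>x. P #> x) ` ?D)"
    unfolding bij_betw_def
  proof
    show "inj_on (\<lambda>(c, t). P #> (comb S c \<otimes> t)) ((\<Pi>\<^sub>E s\<in>S. {0..<int q}) \<times> ?tors)"
    proof (rule inj_onI, clarify)
      fix c t d u
      assume c: "c \<in> (\<Pi>\<^sub>E s\<in>S. {0..<int q})" and d: "d \<in> (\<Pi>\<^sub>E s\<in>S. {0..<int q})"
        and t: "t \<in> carrier G" "t [^] q = \<one>" and u: "u \<in> carrier G" "u [^] q = \<one>"
        and eq: "P #> (comb S c \<otimes> t) = P #> (comb S d \<otimes> u)"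
      have tu: "t \<otimes> inv u \<in> carrier G" "(t \<otimes> inv u) [^] int q = \<one>"
        using t u by (simp_all add: int_pow_distrib int_pow_inv) (simp add: int_pow_int)
      have "comb S c \<otimes> t \<otimes> inv (comb S d \<otimes> u) = comb S (\<lambda>s. c s - d s) \<otimes> (t \<otimes> inv u)"
        using Sc t u by (simp add: comb_diff inv_mult m_ac)
      with eq obtain e where
        e: "comb S (\<lambda>s. c s - d s) \<otimes> (t \<otimes> inv u) = comb S (\<lambda>s. int q * e s)"
        using Sc t u rcos_eq_iff [OF P] Pmem by auto
      \<comment> \<open>Taking q-th powers removes the q-torsion factor
        \<open>t \<otimes> inv u\<close> and leaves a relation in S alone, where coefficients can be
        compared.\<close>
      have "comb S (\<lambda>s. int q * (c s - d s)) = comb S (\<lambda>s. c s - d s) [^] int q \<otimes> (t \<otimes> inv u) [^] int q"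
        using Sc tu by (simp add: comb_pow)
      also have "\<dots> = comb S (\<lambda>s. int q * e s) [^] int q"
        using Sc tu by (simp add: e [symmetric] int_pow_distrib del: r_one)
      finally have "comb S (\<lambda>s. int q * (c s - d s)) = comb S (\<lambda>s. int q * (int q * e s))"
        using Sc by (simp add: comb_pow)
      from comb_eqD [OF S(1) this] q have ce: "c s - d s = int q * e s" if "s \<in> S" for s
        using that by simp
      have cd: "c s = d s" if "s \<in> S" for s
      proof -
        have "c s mod int q = d s mod int q" using ce [OF that] by (simp add: mod_eq_dvd_iff)
        then show ?thesis using c d that by (auto simp: PiE_iff)
      qed
      then have "c = d" by (intro PiE_ext [OF c d])
      have "comb S (\<lambda>s. int q * e s) = comb S (\<lambda>s. 0)"
        using Sc ce cd q by (intro comb_cong) force+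
      with e \<open>c = d\<close> tu have "t \<otimes> inv u = \<one>" by simp
      then have "t = u" using t u by (metis inv_closed inv_equality inv_inv)
      with \<open>c = d\<close> show "c = d \<and> t = u" by simp
    qed
    show "(\<lambda>(c, t). P #> (comb S c \<otimes> t)) ` ((\<Pi>\<^sub>E s\<in>S. {0..<int q}) \<times> ?tors) = (\<lambda>x. P #> x) ` ?D"
    proof (intro equalityI subsetI)
      fix y assume "y \<in> (\<lambda>(c, t). P #> (comb S c \<otimes> t)) ` ((\<Pi>\<^sub>E s\<in>S. {0..<int q}) \<times> ?tors)"
      then obtain c t where y: "y = P #> (comb S c \<otimes> t)" and t: "t \<in> carrier G" "t [^] q = \<one>"
        by auto
      have "(comb S c \<otimes> t) [^] int q = comb S (\<lambda>s. int q * c s)"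
        using Sc t by (simp add: int_pow_distrib comb_pow) (simp add: int_pow_int)
      then show "y \<in> (\<lambda>x. P #> x) ` ?D" using y t Sc by (auto simp: Pmem)
    next
      fix y assume "y \<in> (\<lambda>x. P #> x) ` ?D"
      then obtain x where y: "y = P #> x" and x: "x \<in> carrier G" "x [^] int q \<in> P" by blast
      then obtain d where d: "x [^] int q = comb S (\<lambda>s. int q * d s)" by (auto simp: Pmem)
      \<comment> \<open>\<open>x\<close> and \<open>comb S d\<close> have the same q-th power, so
        they differ by a q-torsion element.\<close>
      define t where "t = inv (comb S d) \<otimes> x"
      have "t [^] int q = inv (comb S (\<lambda>s. int q * d s)) \<otimes> comb S (\<lambda>s. int q * d s)"
        using Sc x by (simp add: t_def int_pow_distrib int_pow_inv comb_pow d)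
      with Sc x have t: "t \<in> carrier G" "t [^] q = \<one>" by (auto simp: t_def int_pow_int)
      define c where "c = (\<lambda>s\<in>S. d s mod int q)"
      have "comb S c \<otimes> t \<otimes> inv x = comb S c \<otimes> inv (comb S d)"
        using Sc x by (simp add: t_def m_assoc)
      also have "\<dots> = comb S (\<lambda>s. c s - d s)" using Sc by (simp add: comb_diff)
      also have "\<dots> = comb S (\<lambda>s. int q * (- (d s div int q)))"
        using Sc by (intro comb_cong) (auto simp: c_def minus_mult_div_eq_mod [symmetric])
      finally have "comb S c \<otimes> t \<otimes> inv x \<in> P" unfolding Pmem by (rule exI [of _ "\<lambda>s. - (d s div int q)"])
      then have "y = P #> (comb S c \<otimes> t)"
        using y rcos_eq_iff [OF P, of "comb S c \<otimes> t" x] Sc t x by simp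
      moreover have "c \<in> (\<Pi>\<^sub>E s\<in>S. {0..<int q})" using q by (auto simp: c_def)
      ultimately show "y \<in> (\<lambda>(c, t). P #> (comb S c \<otimes> t)) ` ((\<Pi>\<^sub>E s\<in>S. {0..<int q}) \<times> ?tors)"
        using t by (auto intro!: image_eqI [of _ _ "(c, t)"])
    qed
  qed
  from bij_betw_same_card [OF this] main show ?thesis
    by (simp add: card_cartesian_product card_PiE Sc)
qed

text \<open>Any independent S' extends to a maximal T. Computing |G/2G| from S and from T gives
  \<open>2 ^ card S * t = 2 ^ card T * t\<close> with t = |G[2]| finite and positive, so |S'| is at
  most |T| = |S|. Any modulus above 1 would do. The bound also shows that \<open>Max\<close> is
  applied to a finite set.\<close>

lemma abelian_rank_eq:
  assumes U: "finite U" "U \<subseteq> carrier G" "generate G U = carrier G"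
    and S: "int_independent G S" "U \<subseteq> rad (generate G S)"
  shows "abelian_rank G = card S"
proof -
  let ?t = "card {x \<in> carrier G. x [^] (2::nat) = \<one>}"
  have "finite {x \<in> carrier G. x [^] (2::nat) = \<one>}"
    by (rule finite_subset [OF _ finite_torsion_set [OF U]])
       (auto simp: torsion_set_def intro!: exI [of _ "2::nat"])
  then have t: "?t > 0" by (auto simp: card_gt_0_iff intro!: exI [of _ \<one>])
  have le: "card S' \<le> card S" if S': "int_independent G S'" for S'
  proof -
    obtain T where T: "S' \<subseteq> T" "int_independent G T" "U \<subseteq> rad (generate G T)"
      using exists_independent_extension [OF S' U(1,2)] by metis
    have "2 ^ card S * ?t = 2 ^ card T * ?t"
      using card_Mod_multiples [OF U S, of 2] card_Mod_multiples [OF U T(2,3), of 2] by simp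
    with t have "card S = card T" by simp
    with T show ?thesis by (metis card_mono int_independent_iff)
  qed
  then have "{card S' |S'. int_independent G S'} \<subseteq> {..card S}" by auto
  then have "finite {card S' |S'. int_independent G S'}" by (rule finite_subset) simp
  then show ?thesis unfolding abelian_rank_def using le S(1) by (intro Max_eqI) auto
qed

section \<open>Ranks of subgroups, quotients and sublists\<close>

lemma comm_group_subgroup: "subgroup K G \<Longrightarrow> comm_group (G\<lparr>carrier := K\<rparr>)"
  by (rule group.group_comm_groupI [OF subgroup_imp_group])
     (auto intro: m_comm dest: subgroup.mem_carrier)

lemma finprod_subgroup:
  assumes K: "subgroup K G" and "S \<subseteq> K" "finite S"
  shows "(\<Otimes>\<^bsub>G\<lparr>carrier := K\<rparr>\<^esub>s\<in>S. s [^]\<^bsub>G\<lparr>carrier := K\<rparr>\<^esub> (c s :: int)) = comb S c"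
  using assms(3,2)
proof (induction S)
  case (insert x S)
  interpret K: comm_group "G\<lparr>carrier := K\<rparr>"
    using K by (rule comm_group_subgroup)
  have pc: "y [^]\<^bsub>G\<lparr>carrier := K\<rparr>\<^esub> (m::int) \<in> K" if "y \<in> K" for y m
    using K.int_pow_closed [of y m] that by simp
  have "(\<Otimes>\<^bsub>G\<lparr>carrier := K\<rparr>\<^esub>s\<in>insert x S. s [^]\<^bsub>G\<lparr>carrier := K\<rparr>\<^esub> c s) =
      x [^]\<^bsub>G\<lparr>carrier := K\<rparr>\<^esub> c x \<otimes>\<^bsub>G\<lparr>carrier := K\<rparr>\<^esub>
      (\<Otimes>\<^bsub>G\<lparr>carrier := K\<rparr>\<^esub>s\<in>S. s [^]\<^bsub>G\<lparr>carrier := K\<rparr>\<^esub> c s)"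
    using insert by (intro K.finprod_insert) (auto intro: pc)
  also have "\<dots> = x [^] c x \<otimes> comb S c"
    using insert int_pow_consistent [OF K, of x] by simp
  also have "\<dots> = comb (insert x S) c"
    using insert subgroup.subset [OF K] by (subst comb_insert) auto
  finally show ?case .
qed (simp add: comb_def comm_monoid.finprod_empty [OF comm_group.axioms(1) [OF comm_group_subgroup [OF K]]])

lemma int_independent_subgroup:
  assumes "subgroup K G" "S \<subseteq> K"
  shows "int_independent (G\<lparr>carrier := K\<rparr>) S \<longleftrightarrow> int_independent G S"
  using assms finprod_subgroup [OF assms] subgroup.subset [OF assms(1)]
  unfolding int_independent_iff by (auto simp: int_independent_def)

text \<open>\<open>rk\<close> is the rank of a different group record, so independence, spans and
  powers have to be identified with those of G before \<open>abelian_rank_eq\<close> applies to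
  it.\<close>

lemma abelian_rank_subgroup_generated:
  assumes U: "finite U" "U \<subseteq> carrier G"
    and S: "int_independent G S" "S \<subseteq> generate G U" "U \<subseteq> rad (generate G S)"
  shows "abelian_rank (subgroup_generated G U) = card S"
proof -
  let ?K = "generate G U"
  have K: "subgroup ?K G" by (rule generate_is_subgroup [OF U(2)])
  have eq: "subgroup_generated G U = G\<lparr>carrier := ?K\<rparr>"
    using U by (simp add: subgroup_generated_def Int_absorb1)
  interpret K: comm_group "G\<lparr>carrier := ?K\<rparr>"
    using K by (rule comm_group_subgroup)
  have UK: "U \<subseteq> ?K" by (auto intro: generate.incl)
  have "abelian_rank (G\<lparr>carrier := ?K\<rparr>) = card S"
  proof (rule K.abelian_rank_eq [OF U(1)])
    show "U \<subseteq> K.rad (generate (G\<lparr>carrier := ?K\<rparr>) S)"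
      using S(3) UK
      by (auto simp: K.rad_def rad_def generate_consistent [OF S(2) K] subset_iff
            nat_pow_consistent [symmetric])
  qed (use UK S in \<open>auto simp: generate_consistent [OF UK K] int_independent_subgroup [OF K]\<close>)
  then show ?thesis by (simp add: eq)
qed

lemma hom_comb:
  assumes "comm_group H" "h \<in> hom G H" "S \<subseteq> carrier G"
  shows "(\<Otimes>\<^bsub>H\<^esub>s\<in>S. h s [^]\<^bsub>H\<^esub> c s) = h (comb S c)"
  using assms(3)
proof (induction S rule: infinite_finite_induct)
  case (insert x S)
  interpret H: comm_group H by fact
  interpret h: group_hom G H h
    by (intro group_hom.intro group_hom_axioms.intro is_group H.is_group assms)
  show ?case using insert
    by (subst H.finprod_insert) (auto simp: comb_insert h.hom_int_pow)
qed (use assms hom_one [of h G H] in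
      \<open>auto simp: comb_def comm_group_def comm_monoid.finprod_infinite comm_monoid.finprod_empty\<close>)

lemma comb_Un_disjoint:
  "finite S \<Longrightarrow> finite D \<Longrightarrow> S \<inter> D = {} \<Longrightarrow> S \<union> D \<subseteq> carrier G \<Longrightarrow>
   comb (S \<union> D) c = comb S c \<otimes> comb D c"
  unfolding comb_def by (rule finprod_Un_disjoint) auto

text \<open>S has the same radical as L, so a combination of T that lies in L has no coefficients on
  D = T - S. Therefore D stays independent modulo L. Since the S part of any combination dies in the
  quotient, D is also maximal there.\<close>

lemma abelian_rank_Mod:
  assumes U: "finite U" "U \<subseteq> carrier G" "generate G U = carrier G"
    and L: "subgroup L G" "S \<subseteq> L" "L \<subseteq> rad (generate G S)"
    and T: "int_independent G T" "S \<subseteq> T" "U \<subseteq> rad (generate G T)"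
  shows "abelian_rank (G Mod L) = card T - card S"
proof -
  let ?p = "\<lambda>x. L #> x"
  define D where "D = T - S"
  have Tc: "finite T" "T \<subseteq> carrier G" using T(1) by (auto simp: int_independent_iff)
  then have Sc: "finite S" "S \<subseteq> carrier G" and Dc: "finite D" "D \<subseteq> carrier G" "D \<subseteq> T"
    using T(2) by (auto simp: D_def intro: finite_subset)
  have TSD: "T = S \<union> D" "S \<inter> D = {}"
    using T(2) by (auto simp: D_def)
  interpret Q: comm_group "G Mod L" by (rule comm_group_Mod [OF L(1)])
  interpret p: group_hom G "G Mod L" ?p by (rule rcos_group_hom [OF L(1)])
  have coeff: "c s = 0" if "comb T c \<in> L" "s \<in> D" for c s
    using comb_coeff_eq_zero [OF T(1,2), of c s] L(3) that by (auto simp: D_def)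
  have inj: "inj_on ?p D"
  proof (rule inj_onI, rule ccontr)
    fix s t assume st: "s \<in> D" "t \<in> D" "?p s = ?p t" "s \<noteq> t"
    \<comment> \<open>If two elements of D had the same coset, their quotient would be an element of
      L with coefficient 1 at s.\<close>
    let ?c = "\<lambda>u. (if u = s then 1 else 0) - (if u = t then 1 else 0 :: int)"
    have "comb T ?c = s \<otimes> inv t"
      using st Dc Tc by (subst comb_diff) (auto simp: comb_single subset_iff)
    also have "\<dots> \<in> L" using st Dc rcos_eq_iff [OF L(1), of s t] by blast
    finally show False using coeff [of ?c s] st by auto
  qed
  have homc: "(\<Otimes>\<^bsub>G Mod L\<^esub>s\<in>D. ?p s [^]\<^bsub>G Mod L\<^esub> c s) = ?p (comb D c)" for c :: "'a \<Rightarrow> int"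
    by (rule hom_comb [OF Q.comm_group_axioms rcos_hom [OF L(1)] Dc(2)])
  have "abelian_rank (G Mod L) = card (?p ` D)"
  proof (rule Q.abelian_rank_eq)
    show "finite (?p ` U)" "?p ` U \<subseteq> carrier (G Mod L)"
      using U by (auto simp: carrier_FactGroup)
    show "generate (G Mod L) (?p ` U) = carrier (G Mod L)" by (rule generate_Mod [OF L(1) U(2,3)])
    have "c (?p s) = 0"
      if "(\<Otimes>\<^bsub>G Mod L\<^esub>y\<in>?p ` D. y [^]\<^bsub>G Mod L\<^esub> c y) = \<one>\<^bsub>G Mod L\<^esub>" "s \<in> D"
      for s and c :: "'a set \<Rightarrow> int"
    proof -
      have "(\<Otimes>\<^bsub>G Mod L\<^esub>y\<in>?p ` D. y [^]\<^bsub>G Mod L\<^esub> c y) = ?p (comb D (\<lambda>s. c (?p s)))"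
        using Dc inj by (subst Q.finprod_reindex) (auto simp: homc intro!: Q.int_pow_closed)
      with that have "comb D (\<lambda>s. c (?p s)) \<in> L"
        using rcos_eq_self_iff [OF L(1)] Dc by simp
      moreover have "comb D (\<lambda>s. c (?p s)) = comb T (\<lambda>s. if s \<in> D then c (?p s) else 0)"
        using Tc Dc by (subst comb_extend [of T D]) (auto intro: comb_cong)
      ultimately show ?thesis using coeff [of "\<lambda>s. if s \<in> D then c (?p s) else 0" s] that by auto
    qed
    then show "int_independent (G Mod L) (?p ` D)"
      using Dc by (auto simp: int_independent_def intro!: p.hom_closed)
    show "?p ` U \<subseteq> Q.rad (generate (G Mod L) (?p ` D))"
    proof clarify
      fix x assume x: "x \<in> U"
      with T(3) Tc obtain n :: nat and c where n: "n > 0" "x [^] n = comb T c"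
        by (auto simp: rad_def generate_eq_range_comb)
      have xc: "x \<in> carrier G" using x U by auto
      have "comb S c \<in> L" by (rule comb_in_subgroup [OF L(1,2)])
      have "x [^] n \<otimes> inv (comb D c) = comb S c"
        using n(2) Sc Dc by (simp add: TSD(1) comb_Un_disjoint [OF _ _ TSD(2)] m_assoc)
      then have "?p (x [^] n) = ?p (comb D c)"
        using \<open>comb S c \<in> L\<close> xc Dc rcos_eq_iff [OF L(1)] by simp
      moreover have "?p (comb D c) \<in> generate (G Mod L) (?p ` D)"
        using Dc by (simp add: p.generate_img generate_eq_range_comb)
      ultimately show "?p x \<in> Q.rad (generate (G Mod L) (?p ` D))"
        using n xc p.hom_closed by (auto simp: Q.rad_def Mod_nat_pow [OF L(1)])
    qed
  qed
  also have "\<dots> = card T - card S"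
    using card_image [OF inj] T(2) Sc by (simp add: D_def card_Diff_subset)
  finally show ?thesis .
qed

text \<open>The list may repeat elements, so a basis is a set of indices on which g is injective.
  One preimage is chosen for each new element of T, and the indices in B are kept.\<close>

lemma exists_index_basis:
  assumes "finite A" "g \<in> A \<rightarrow> carrier G" "B \<subseteq> A" "inj_on g B" "int_independent G (g ` B)"
  obtains C where "B \<subseteq> C" "C \<subseteq> A" "inj_on g C" "int_independent G (g ` C)"
    "g ` A \<subseteq> rad (generate G (g ` C))"
proof -
  obtain T where T: "g ` B \<subseteq> T" "T \<subseteq> g ` B \<union> g ` A" "int_independent G T"
    "g ` A \<subseteq> rad (generate G T)"
    using exists_independent_extension [OF assms(5), of "g ` A"] assms(1,2) by blast
  have TA: "T - g ` B \<subseteq> g ` A" using T(2) assms(3) by auto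
  have gt: "g (inv_into A g t) = t" if "t \<in> T - g ` B" for t
    using TA that by (meson f_inv_into_f subsetD)
  define D where "D = inv_into A g ` (T - g ` B)"
  have gD: "g ` D = T - g ` B"
    by (simp add: D_def image_image gt)
  have DA: "D \<subseteq> A"
    unfolding D_def by (rule image_subsetI) (metis TA inv_into_into subsetD)
  have "inj_on g D"
    by (auto simp: D_def inj_on_def gt)
  then have "inj_on g (B \<union> D)"
    using assms(4) gD by (auto simp: inj_on_Un)
  moreover have "g ` (B \<union> D) = T" using gD T(1) by auto
  ultimately show thesis using that [of "B \<union> D"] T assms(3) DA by auto
qed

lemma rk_eq_card:
  assumes "finite A" "g \<in> A \<rightarrow> carrier G" "C \<subseteq> A" "inj_on g C" "int_independent G (g ` C)"
    "g ` A \<subseteq> rad (generate G (g ` C))"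
  shows "rk G g A = card C"
proof -
  have "g ` C \<subseteq> generate G (g ` A)"
    using assms(3) by (auto intro: generate.incl)
  then show ?thesis
    unfolding rk_def using assms
    by (subst abelian_rank_subgroup_generated [of _ "g ` C"]) (auto simp: card_image)
qed

lemma rk_le_card:
  assumes "finite A" "g \<in> A \<rightarrow> carrier G"
  shows "rk G g A \<le> card A"
proof -
  obtain C where C: "C \<subseteq> A" "inj_on g C" "int_independent G (g ` C)"
    "g ` A \<subseteq> rad (generate G (g ` C))"
    using exists_index_basis [OF assms, of "{}"] by auto
  then show ?thesis using rk_eq_card [OF assms C] assms(1) by (simp add: card_mono)
qed

lemma rk_mono:
  assumes "finite E" "g \<in> E \<rightarrow> carrier G" "A \<subseteq> E"
  shows "rk G g A \<le> rk G g E"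
proof -
  have A: "finite A" "g \<in> A \<rightarrow> carrier G" using assms by (auto intro: finite_subset)
  obtain C where C: "C \<subseteq> A" "inj_on g C" "int_independent G (g ` C)"
    "g ` A \<subseteq> rad (generate G (g ` C))"
    using exists_index_basis [OF A, of "{}"] by auto
  then have "C \<subseteq> E" using assms(3) by auto
  then obtain B where B: "C \<subseteq> B" "B \<subseteq> E" "inj_on g B" "int_independent G (g ` B)"
    "g ` E \<subseteq> rad (generate G (g ` B))"
    using exists_index_basis [OF assms(1,2) _ C(2,3)] by blast
  have "rk G g A = card C" by (rule rk_eq_card [OF A C])
  also have "\<dots> \<le> card B" using B assms(1) by (intro card_mono) (auto intro: finite_subset)
  also have "\<dots> = rk G g E" by (rule rk_eq_card [OF assms(1,2) B(2-), symmetric])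
  finally show ?thesis .
qed

text \<open>The second conclusion makes the truncated subtraction in the first a true
  difference.\<close>

lemma abelian_rank_list_quotient:
  assumes U: "finite U" "U \<subseteq> carrier G" "generate G U = carrier G"
    and A: "finite A" "g \<in> A \<rightarrow> carrier G"
  shows "abelian_rank (list_quotient G g A) = abelian_rank G - rk G g A"
    and "rk G g A \<le> abelian_rank G"
proof -
  obtain C where C: "C \<subseteq> A" "inj_on g C" "int_independent G (g ` C)"
    "g ` A \<subseteq> rad (generate G (g ` C))"
    using exists_index_basis [OF A, of "{}"] by auto
  obtain T where T: "g ` C \<subseteq> T" "int_independent G T" "U \<subseteq> rad (generate G T)"
    using exists_independent_extension [OF C(3) U(1,2)] by metis
  have gA: "g ` A \<subseteq> carrier G" using A by auto
  have gC: "subgroup (generate G (g ` C)) G"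
    using C(3) by (auto simp: int_independent_iff intro: generate_is_subgroup)
  have rkA: "rk G g A = card (g ` C)"
    using rk_eq_card [OF A C] card_image [OF C(2)] by simp
  have rkG: "abelian_rank G = card T" by (rule abelian_rank_eq [OF U T(2,3)])
  show "rk G g A \<le> abelian_rank G"
    unfolding rkA rkG using T by (intro card_mono) (auto simp: int_independent_iff)
  have "abelian_rank (G Mod generate G (g ` A)) = card T - card (g ` C)"
  proof (rule abelian_rank_Mod [OF U])
    show "generate G (g ` A) \<subseteq> rad (generate G (g ` C))" by (rule generate_le_rad [OF gC C(4)])
    show "g ` C \<subseteq> generate G (g ` A)" using C(1) by (auto intro: generate.incl)
  qed (use T gA in \<open>auto intro: generate_is_subgroup\<close>)
  then show "abelian_rank (list_quotient G g A) = abelian_rank G - rk G g A"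
    by (simp add: list_quotient_def rkA rkG)
qed

end

section \<open>Duality for finite abelian groups\<close>

context comm_group
begin

section \<open>Extending homomorphisms into Z/q by one element\<close>

lemma hom_integer_mod_int_pow:
  assumes K: "subgroup K G" and f: "\<phi> \<in> hom (G\<lparr>carrier := K\<rparr>) (integer_mod_group q)" and "k \<in> K"
  shows "\<phi> (k [^] (m::int)) = (m * \<phi> k) mod int q"
proof -
  interpret f: group_hom "G\<lparr>carrier := K\<rparr>" "integer_mod_group q" \<phi>
    by (intro group_hom.intro group_hom_axioms.intro subgroup_imp_group K f group_integer_mod_group)
  show ?thesis
    using f.hom_int_pow [of k m] \<open>k \<in> K\<close> int_pow_consistent [OF K \<open>k \<in> K\<close>, of m]
    by (simp add: int_pow_integer_mod_group)
qed

text \<open>n is the order of the coset of x in \<open>G Mod K\<close>; it divides q because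
  \<open>x [^] q\<close> is in K.\<close>

lemma exponent_mod_subgroup:
  assumes K: "subgroup K G" and x: "x \<in> carrier G" and q: "q > 0" "x [^] q \<in> K"
  obtains n :: nat where "n > 0" "n dvd q" "\<And>i::int. x [^] i \<in> K \<longleftrightarrow> int n dvd i"
proof -
  interpret Q: comm_group "G Mod K" by (rule comm_group_Mod [OF K])
  have Kx: "K #> x \<in> carrier (G Mod K)" using x by (simp add: carrier_FactGroup)
  have iff: "x [^] i \<in> K \<longleftrightarrow> int (Q.ord (K #> x)) dvd i" for i :: int
    using Q.int_pow_eq_id [OF Kx, of i] x
    by (simp add: Mod_int_pow [OF K] rcos_eq_self_iff [OF K])
  moreover from this [of "int q"] q have "Q.ord (K #> x) dvd q" by (simp add: int_pow_int)
  moreover from this q have "Q.ord (K #> x) > 0" by (auto intro: Nat.gr0I)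
  ultimately show thesis using that by blast
qed

lemma mem_adjoin_iff:
  assumes "x \<in> carrier G"
  shows "z \<in> K <#> generate G {x} \<longleftrightarrow> (\<exists>k\<in>K. \<exists>i::int. z = k \<otimes> x [^] i)"
  using generate_pow [OF assms] by (auto simp: set_mult_def)

lemma subgroup_adjoin: "subgroup K G \<Longrightarrow> x \<in> carrier G \<Longrightarrow> subgroup (K <#> generate G {x}) G"
  by (intro mult_subgroups generate_is_subgroup) auto

text \<open>Two ways of writing an element of the enlarged subgroup differ only by moving an element
  of the intersection of K and the span of x from one factor to the other. Both the size of that
  subgroup and the consistency of extensions rest on this.\<close>

lemma adjoin_rep_eq:
  assumes K: "subgroup K G" and x: "x \<in> carrier G" and k: "k \<in> K" "k' \<in> K"
    and eq: "k \<otimes> x [^] (i::int) = k' \<otimes> x [^] (j::int)"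
  shows "k' = k \<otimes> x [^] (i - j)" and "x [^] (i - j) \<in> K"
proof -
  have kc: "k \<in> carrier G" "k' \<in> carrier G" using k K by (auto dest: subgroup.mem_carrier)
  have "k \<otimes> x [^] (i - j) = k \<otimes> x [^] i \<otimes> inv (x [^] j)"
    using kc x by (simp add: int_pow_diff m_assoc)
  also have "\<dots> = k'" using kc x by (simp add: eq m_assoc)
  finally show *: "k' = k \<otimes> x [^] (i - j)" ..
  have "x [^] (i - j) = inv k \<otimes> k'" using kc x by (simp add: * m_assoc [symmetric])
  also have "\<dots> \<in> K" using k by (intro subgroup.m_closed [OF K] subgroup.m_inv_closed [OF K])
  finally show "x [^] (i - j) \<in> K" .
qed

lemma card_adjoin:
  assumes K: "subgroup K G" and x: "x \<in> carrier G"
    and n: "n > 0" "\<And>i::int. x [^] i \<in> K \<longleftrightarrow> int n dvd i"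
  shows "card (K <#> generate G {x}) = n * card K"
proof -
  have "bij_betw (\<lambda>(k, i). k \<otimes> x [^] i) (K \<times> {0..<int n}) (K <#> generate G {x})"
    unfolding bij_betw_def
  proof
    show "inj_on (\<lambda>(k, i). k \<otimes> x [^] i) (K \<times> {0..<int n})"
    proof (rule inj_onI, clarify)
      fix k k' and i j :: int
      assume k: "k \<in> K" "k' \<in> K" and ij: "i \<in> {0..<int n}" "j \<in> {0..<int n}"
        and eq: "k \<otimes> x [^] i = k' \<otimes> x [^] j"
      have "int n dvd i - j" using adjoin_rep_eq(2) [OF K x k eq] n(2) by simp
      then have "i mod int n = j mod int n" by (simp add: mod_eq_dvd_iff)
      with ij have "i = j" by simp
      moreover from this have "k' = k"
        using adjoin_rep_eq(1) [OF K x k eq] k K by (simp add: subgroup.mem_carrier)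
      ultimately show "k = k' \<and> i = j" by simp
    qed
    show "(\<lambda>(k, i). k \<otimes> x [^] i) ` (K \<times> {0..<int n}) = K <#> generate G {x}"
    proof (intro equalityI subsetI)
      fix z assume "z \<in> K <#> generate G {x}"
      then obtain k and i :: int where k: "k \<in> K" and z: "z = k \<otimes> x [^] i"
        using mem_adjoin_iff [OF x] by blast
      let ?m = "int n * (i div int n)"
      have "x [^] i = x [^] (?m + i mod int n)" by simp
      also have "\<dots> = x [^] ?m \<otimes> x [^] (i mod int n)" by (rule int_pow_mult [OF x])
      finally have "z = (k \<otimes> x [^] ?m) \<otimes> x [^] (i mod int n)"
        using z k x K by (simp add: m_assoc subgroup.mem_carrier)
      moreover have "k \<otimes> x [^] ?m \<in> K" using k n(2) by (auto intro: subgroup.m_closed [OF K])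
      ultimately show "z \<in> (\<lambda>(k, i). k \<otimes> x [^] i) ` (K \<times> {0..<int n})"
        using n(1) by (auto intro!: image_eqI [of _ _ "(k \<otimes> x [^] ?m, i mod int n)"])
    qed (auto simp: mem_adjoin_iff [OF x])
  qed
  from bij_betw_same_card [OF this] show ?thesis
    by (simp add: card_cartesian_product mult.commute)
qed

text \<open>The hypothesis on y says that the two prescriptions, \<open>\<phi>\<close> on K and i *
  y on the powers of x, agree where K meets the span of x. The value \<open>v\<close> then does not
  depend on the representation, so \<open>\<psi>\<close> may use an arbitrary one.\<close>

lemma hom_adjoin_extension:
  assumes K: "subgroup K G" and x: "x \<in> carrier G"
    and f: "\<phi> \<in> hom (G\<lparr>carrier := K\<rparr>) (integer_mod_group q)" and "q > 0"
    and y: "\<And>i::int. x [^] i \<in> K \<Longrightarrow> \<phi> (x [^] i) = (i * y) mod int q"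
  obtains \<psi> where
    "\<psi> \<in> hom (G\<lparr>carrier := K <#> generate G {x}\<rparr>) (integer_mod_group q)"
    "\<And>k i. k \<in> K \<Longrightarrow> \<psi> (k \<otimes> x [^] (i::int)) = (\<phi> k + i * y) mod int q"
proof -
  let ?K = "K <#> generate G {x}"
  define v where "v = (\<lambda>(k, i::int). (\<phi> k + i * y) mod int q)"
  have add: "\<phi> (k \<otimes> k') = (\<phi> k + \<phi> k') mod int q" if "k \<in> K" "k' \<in> K" for k k'
    using hom_mult [OF f] that by simp
  have wd: "v (k, i) = v (k', j)"
    if k: "k \<in> K" "k' \<in> K" and eq: "k \<otimes> x [^] i = k' \<otimes> x [^] j" for k k' i j
  proof -
    note r = adjoin_rep_eq [OF K x k eq]
    have "\<phi> k' = (\<phi> k + (i - j) * y) mod int q"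
      using add [OF k(1) r(2)] y [OF r(2)] r(1) by (simp add: mod_add_right_eq)
    then have "v (k', j) = (\<phi> k + (i - j) * y + j * y) mod int q"
      by (simp add: v_def mod_add_left_eq)
    then show ?thesis by (simp add: v_def algebra_simps)
  qed
  define \<psi> where "\<psi> z = v (SOME p. fst p \<in> K \<and> z = fst p \<otimes> x [^] (snd p :: int))" for z
  have \<psi>: "\<psi> (k \<otimes> x [^] i) = (\<phi> k + i * y) mod int q" if "k \<in> K" for k i
  proof -
    let ?P = "\<lambda>p. fst p \<in> K \<and> k \<otimes> x [^] i = fst p \<otimes> x [^] (snd p :: int)"
    have "?P (k, i)" using that by simp
    then have "?P (SOME p. ?P p)" by (rule someI)
    then have "v (k, i) = v (fst (SOME p. ?P p), snd (SOME p. ?P p))"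
      by (intro wd that) auto
    then show ?thesis by (simp add: \<psi>_def) (simp add: v_def)
  qed
  have "\<psi> \<in> hom (G\<lparr>carrier := ?K\<rparr>) (integer_mod_group q)"
  proof (rule homI)
    fix z assume "z \<in> carrier (G\<lparr>carrier := ?K\<rparr>)"
    then obtain k and i :: int where "k \<in> K" "z = k \<otimes> x [^] i"
      using mem_adjoin_iff [OF x] by auto
    then show "\<psi> z \<in> carrier (integer_mod_group q)"
      using \<open>q > 0\<close> by (simp add: \<psi> carrier_integer_mod_group)
    fix w assume "w \<in> carrier (G\<lparr>carrier := ?K\<rparr>)"
    then obtain l and j :: int where l: "l \<in> K" "w = l \<otimes> x [^] j"
      using mem_adjoin_iff [OF x] by auto
    note kz = \<open>k \<in> K\<close> \<open>z = k \<otimes> x [^] i\<close>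
    have c: "k \<in> carrier G" "l \<in> carrier G" using l kz K by (auto dest: subgroup.mem_carrier)
    have "z \<otimes> w = (k \<otimes> l) \<otimes> x [^] (i + j)" using l kz c x by (simp add: int_pow_mult m_ac)
    then have "\<psi> (z \<otimes> w) = (\<phi> (k \<otimes> l) + (i + j) * y) mod int q"
      using \<psi> subgroup.m_closed [OF K kz(1) l(1)] by simp
    also have "\<dots> = ((\<phi> k + i * y) + (\<phi> l + j * y)) mod int q"
      by (simp add: add [OF kz(1) l(1)] mod_add_left_eq) (simp add: algebra_simps)
    also have "\<dots> = (\<psi> z + \<psi> w) mod int q"
      using l kz \<psi> by (simp add: mod_add_eq)
    finally show "\<psi> (z \<otimes>\<^bsub>G\<lparr>carrier := ?K\<rparr>\<^esub> w) = \<psi> z \<otimes>\<^bsub>integer_mod_group q\<^esub> \<psi> w"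
      by simp
  qed
  then show thesis using \<psi> that by blast
qed

end

text \<open>With q = n r and c = n d the congruence becomes y mod r = d, and the solutions below q
  are d + r j for 0 <= j < n.\<close>

lemma card_mult_cong_solutions:
  fixes c :: int
  assumes "n > 0" "n dvd q" "q > 0" "int n dvd c" "0 \<le> c" "c < int q"
  shows "card {y \<in> {0..<int q}. (int n * y) mod int q = c} = n"
proof -
  obtain r where r: "q = n * r" using assms(2) by blast
  obtain d where d: "c = int n * d" using assms(4) by blast
  have rp: "r > 0" using r assms by simp
  have d0: "0 \<le> d" "d < int r"
    using assms r d by (auto simp: zero_le_mult_iff)
  have iff: "(int n * y) mod int q = c \<longleftrightarrow> y mod int r = d" for y
    using assms(1) by (simp add: r d mult_mod_right [symmetric])
  have "bij_betw (\<lambda>j. d + int r * j) {0..<int n} {y \<in> {0..<int q}. y mod int r = d}"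
    unfolding bij_betw_def
  proof
    show "inj_on (\<lambda>j. d + int r * j) {0..<int n}" using rp by (auto simp: inj_on_def)
    show "(\<lambda>j. d + int r * j) ` {0..<int n} = {y \<in> {0..<int q}. y mod int r = d}"
    proof (intro equalityI subsetI)
      fix y assume "y \<in> (\<lambda>j. d + int r * j) ` {0..<int n}"
      then obtain j where j: "0 \<le> j" "j < int n" "y = d + int r * j" by auto
      have "int r * j + int r \<le> int r * int n"
        using j rp mult_left_mono [of "j + 1" "int n" "int r"] by (simp add: algebra_simps)
      then show "y \<in> {y \<in> {0..<int q}. y mod int r = d}"
        using j d0 r by (auto simp: mult.commute)
    next
      fix y assume y: "y \<in> {y \<in> {0..<int q}. y mod int r = d}"
      have eq: "y = d + int r * (y div int r)" using y by auto
      have "y < int r * int n" using y r by (simp add: mult.commute)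
      moreover have "0 \<le> y mod int r" using rp by simp
      ultimately have "int r * (y div int r) < int r * int n"
        using mult_div_mod_eq [of "int r" y] by linarith
      then have "y div int r < int n" using rp by simp
      moreover have "y div int r \<ge> 0" using y rp by (auto simp: pos_imp_zdiv_nonneg_iff)
      ultimately show "y \<in> (\<lambda>j. d + int r * j) ` {0..<int n}"
        using eq by (intro image_eqI [of _ _ "y div int r"]) auto
    qed
  qed
  from bij_betw_same_card [OF this] show ?thesis
    unfolding iff by simp
qed

context comm_group
begin

text \<open>A homomorphism \<open>\<phi>\<close> on \<open>K\<close> extends to \<open>\<langle>K, x\<rangle>\<close> by any \<open>y\<close> with \<open>n y = \<phi> (x ^ n)\<close>, \<open>n\<close> being the order
  of \<open>x\<close> modulo \<open>K\<close>. As \<open>n\<close> divides \<open>q\<close> and \<open>\<phi> (x ^ q) = 0\<close>, there are exactly \<open>n\<close> such \<open>y\<close>.\<close>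

lemma card_hom_adjoin:
  assumes K: "subgroup K G" and x: "x \<in> carrier G" and q: "q > 0" "x [^] q = \<one>"
    and fin: "finite (carrier G)"
    and card: "card (hom (G\<lparr>carrier := K\<rparr>) (integer_mod_group q) \<inter> extensional K) = card K"
  shows "card (hom (G\<lparr>carrier := K <#> generate G {x}\<rparr>) (integer_mod_group q)
                \<inter> extensional (K <#> generate G {x})) = card (K <#> generate G {x})"
proof -
  let ?Z = "integer_mod_group q" and ?K = "K <#> generate G {x}"
  let ?H = "\<lambda>K. hom (G\<lparr>carrier := K\<rparr>) ?Z \<inter> extensional K"
  have "x [^] q \<in> K" using subgroup.one_closed [OF K] by (simp add: q)
  then obtain n :: nat where n: "n > 0" "n dvd q" "\<And>i::int. x [^] i \<in> K \<longleftrightarrow> int n dvd i"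
    using exponent_mod_subgroup [OF K x q(1)] by blast
  have K': "subgroup ?K G" by (rule subgroup_adjoin [OF K x])
  have xn: "x [^] int n \<in> K" using n by simp
  have xK: "x \<in> ?K"
    using mem_adjoin_iff [OF x] subgroup.one_closed [OF K] x
    by (auto intro!: bexI [of _ \<one>] exI [of _ 1])
  have KK: "K \<subseteq> ?K"
    using mem_adjoin_iff [OF x] subgroup.subset [OF K] x by (force intro!: exI [of _ 0])
  have finK: "finite K" using fin subgroup.subset [OF K] by (rule finite_subset [rotated])
  define Y where "Y \<phi> = {y \<in> {0..<int q}. (int n * y) mod int q = \<phi> (x [^] int n)}" for \<phi> :: "'a \<Rightarrow> int"
  have cardY: "card (Y \<phi>) = n" if "\<phi> \<in> ?H K" for \<phi>
    unfolding Y_def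
  proof (rule card_mult_cong_solutions [OF n(1,2) q(1)])
    have f: "\<phi> \<in> hom (G\<lparr>carrier := K\<rparr>) ?Z" using that by blast
    show r: "0 \<le> \<phi> (x [^] int n)" "\<phi> (x [^] int n) < int q"
      using hom_in_carrier [OF f, of "x [^] int n"] xn q by (auto simp: carrier_integer_mod_group)
    obtain r where r: "q = n * r" using n(2) by blast
    have "(x [^] int n) [^] int r = \<one>"
      using q(2) x r by (simp add: int_pow_int nat_pow_pow)
    moreover have "\<phi> \<one> = 0"
      using hom_integer_mod_int_pow [OF K f subgroup.one_closed [OF K], of 0] by simp
    ultimately have "(int r * \<phi> (x [^] int n)) mod int q = 0"
      using hom_integer_mod_int_pow [OF K f xn, of "int r"] by simp
    then show "int n dvd \<phi> (x [^] int n)"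
      using r q(1) by (auto simp: mod_eq_0_iff_dvd mult.commute)
  qed
  have bij: "bij_betw (\<lambda>\<psi>. (restrict \<psi> K, \<psi> x)) (?H ?K) (Sigma (?H K) Y)"
    unfolding bij_betw_def
  proof
    have val: "\<psi> (k \<otimes> x [^] i) = (\<psi> k + i * \<psi> x) mod int q"
      if "\<psi> \<in> ?H ?K" "k \<in> K" for \<psi> k and i :: int
    proof -
      have f: "\<psi> \<in> hom (G\<lparr>carrier := ?K\<rparr>) ?Z" using that by blast
      have "\<psi> (k \<otimes> x [^] i) = (\<psi> k + \<psi> (x [^] i)) mod int q"
        using hom_mult [OF f, of k "x [^] i"] that KK subgroup_int_pow_closed [OF K' xK] by auto
      then show ?thesis
        by (simp add: hom_integer_mod_int_pow [OF K' f xK] mod_add_right_eq)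
    qed
    show "inj_on (\<lambda>\<psi>. (restrict \<psi> K, \<psi> x)) (?H ?K)"
    proof (rule inj_onI)
      fix \<psi> \<psi>' assume h: "\<psi> \<in> ?H ?K" "\<psi>' \<in> ?H ?K"
        and eq: "(restrict \<psi> K, \<psi> x) = (restrict \<psi>' K, \<psi>' x)"
      then have eqK: "\<psi> k = \<psi>' k" if "k \<in> K" for k
        using that by (metis prod.inject restrict_apply')
      show "\<psi> = \<psi>'"
      proof (rule extensionalityI [of _ ?K])
        fix z assume "z \<in> ?K"
        then obtain k and i :: int where "k \<in> K" "z = k \<otimes> x [^] i"
          using mem_adjoin_iff [OF x] by blast
        then show "\<psi> z = \<psi>' z"
          using val [OF h(1), of k i] val [OF h(2), of k i] eqK eq by simp
      qed (use h in auto)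
    qed
    show "(\<lambda>\<psi>. (restrict \<psi> K, \<psi> x)) ` ?H ?K = Sigma (?H K) Y"
    proof (intro equalityI subsetI)
      fix p assume "p \<in> (\<lambda>\<psi>. (restrict \<psi> K, \<psi> x)) ` ?H ?K"
      then obtain \<psi> where h: "\<psi> \<in> ?H ?K" and p: "p = (restrict \<psi> K, \<psi> x)" by blast
      have f: "\<psi> \<in> hom (G\<lparr>carrier := ?K\<rparr>) ?Z" using h by blast
      have "\<psi> (k \<otimes> l) = (\<psi> k + \<psi> l) mod int q" "\<psi> k \<in> carrier ?Z" "k \<otimes> l \<in> K"
        if "k \<in> K" "l \<in> K" for k l
        using that KK hom_mult [OF f, of k l] hom_in_carrier [OF f, of k] subgroup.m_closed [OF K]
        by auto
      then have "restrict \<psi> K \<in> ?H K" by (auto intro!: homI)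
      moreover have "\<psi> x \<in> Y (restrict \<psi> K)"
        using hom_in_carrier [OF f, of x] xK xn q hom_integer_mod_int_pow [OF K' f xK, of "int n"]
        by (auto simp: Y_def carrier_integer_mod_group)
      ultimately show "p \<in> Sigma (?H K) Y" using p by simp
    next
      fix p assume "p \<in> Sigma (?H K) Y"
      then obtain \<phi> y where p: "p = (\<phi>, y)" and h: "\<phi> \<in> ?H K" and y: "y \<in> Y \<phi>" by auto
      have f: "\<phi> \<in> hom (G\<lparr>carrier := K\<rparr>) ?Z" using h by blast
      \<comment> \<open>Exponents for which the power of x lies in K are multiples of n, so the
        single equation for \<open>x [^] int n\<close> gives compatibility for all of them.\<close>
      have comp: "\<phi> (x [^] i) = (i * y) mod int q" if "x [^] i \<in> K" for i :: int
      proof -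
        from that have "int n dvd i" by (simp add: n(3))
        then obtain m where m: "i = int n * m" by (rule dvdE)
        have "\<phi> ((x [^] int n) [^] m) = (m * \<phi> (x [^] int n)) mod int q"
          by (rule hom_integer_mod_int_pow [OF K f xn])
        also have "\<dots> = (m * ((int n * y) mod int q)) mod int q" using y by (simp add: Y_def)
        also have "\<dots> = (i * y) mod int q" by (simp add: m mod_mult_right_eq mult_ac)
        finally show ?thesis using x m by (simp add: int_pow_pow)
      qed
      obtain \<psi> where \<psi>: "\<psi> \<in> hom (G\<lparr>carrier := ?K\<rparr>) ?Z"
        "\<And>k i. k \<in> K \<Longrightarrow> \<psi> (k \<otimes> x [^] (i::int)) = (\<phi> k + i * y) mod int q"
        using hom_adjoin_extension [OF K x f q(1) comp] by blast
      have "\<psi> k = \<phi> k" if "k \<in> K" for k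
        using \<psi>(2) [OF that, of 0] hom_in_carrier [OF f, of k] that q subgroup.mem_carrier [OF K that]
        by (simp add: carrier_integer_mod_group)
      moreover have "\<phi> \<one> = 0"
        using hom_integer_mod_int_pow [OF K f subgroup.one_closed [OF K], of 0] by simp
      then have "\<psi> x = y"
        using \<psi>(2) [OF subgroup.one_closed [OF K], of 1] y x by (simp add: Y_def)
      ultimately have "p = (restrict (restrict \<psi> ?K) K, restrict \<psi> ?K x)"
        using p h KK xK by (auto simp: restrict_def extensional_def fun_eq_iff)
      moreover have "restrict \<psi> ?K \<in> ?H ?K"
        using \<psi>(1) subgroup.m_closed [OF K'] by (auto simp: hom_def)
      ultimately show "p \<in> (\<lambda>\<psi>. (restrict \<psi> K, \<psi> x)) ` ?H ?K"
        by (rule image_eqI [where x = "restrict \<psi> ?K"])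
    qed
  qed
  have "card (?H ?K) = (\<Sum>\<phi>\<in>?H K. card (Y \<phi>))"
  proof -
    have "finite (?H K)"
      using card finK subgroup.one_closed [OF K] by (metis card_gt_0_iff empty_iff)
    moreover have "finite (Y \<phi>)" for \<phi>
      unfolding Y_def by (rule finite_subset [of _ "{0..<int q}"]) auto
    ultimately show ?thesis
      using bij_betw_same_card [OF bij] by simp
  qed
  also have "\<dots> = n * card K" using cardY card by simp
  finally show ?thesis using card_adjoin [OF K x n(1,3)] by simp
qed

text \<open>A subgroup that is maximal among those with as many homomorphisms as elements absorbs
  every x, since adjoining x preserves the property. Hence it is all of G, and no choice of cyclic
  factors is made.\<close>

theorem card_hom_integer_mod:
  assumes fin: "finite (carrier G)" and q: "q > 0" "\<And>x. x \<in> carrier G \<Longrightarrow> x [^] q = \<one>"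
  shows "card (hom G (integer_mod_group q) \<inter> extensional (carrier G)) = card (carrier G)"
proof -
  let ?Z = "integer_mod_group q"
  define F where
    "F = {K. subgroup K G \<and> card (hom (G\<lparr>carrier := K\<rparr>) ?Z \<inter> extensional K) = card K}"
  have "finite F"
    by (rule finite_subset [of _ "Pow (carrier G)"]) (auto simp: F_def fin dest: subgroup.subset)
  moreover have "hom (G\<lparr>carrier := {\<one>}\<rparr>) ?Z \<inter> extensional {\<one>} = {restrict (\<lambda>x. 0) {\<one>}}"
  proof (intro equalityI subsetI)
    fix \<phi> assume h: "\<phi> \<in> hom (G\<lparr>carrier := {\<one>}\<rparr>) ?Z \<inter> extensional {\<one>}"
    then have "\<phi> (\<one> [^] (0::int)) = 0"
      by (subst hom_integer_mod_int_pow [OF triv_subgroup, of _ q]) auto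
    with h show "\<phi> \<in> {restrict (\<lambda>x. 0) {\<one>}}"
      by (auto simp: extensional_def restrict_def fun_eq_iff)
  qed (auto simp: hom_def)
  then have "{\<one>} \<in> F" by (simp add: F_def triv_subgroup)
  ultimately obtain K where K: "K \<in> F" and max: "\<And>K'. K' \<in> F \<Longrightarrow> K \<subseteq> K' \<Longrightarrow> K' = K"
    using finite_has_maximal [of F] by (metis empty_iff)
  then have sub: "subgroup K G" by (simp add: F_def)
  have "x \<in> K" if x: "x \<in> carrier G" for x
  proof -
    let ?K = "K <#> generate G {x}"
    have "?K \<in> F"
      using card_hom_adjoin [OF sub x q(1) q(2) [OF x] fin] K subgroup_adjoin [OF sub x]
      by (simp add: F_def)
    moreover have "K \<subseteq> ?K"
      using mem_adjoin_iff [OF x] subgroup.subset [OF sub] x by (force intro!: exI [of _ 0])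
    moreover have "x \<in> ?K"
      using mem_adjoin_iff [OF x] subgroup.one_closed [OF sub] x
      by (auto intro!: bexI [of _ \<one>] exI [of _ 1])
    ultimately show ?thesis using max by blast
  qed
  then have "K = carrier G" using subgroup.subset [OF sub] by blast
  with K show ?thesis by (simp add: F_def)
qed

lemma card_hom_factor:
  assumes c: "c \<in> hom G B" "c ` carrier G = carrier B" and B: "group B" and Z: "group Z"
  shows "card {\<phi> \<in> hom G Z \<inter> extensional (carrier G).
            \<forall>x\<in>carrier G. c x = \<one>\<^bsub>B\<^esub> \<longrightarrow> \<phi> x = \<one>\<^bsub>Z\<^esub>}
       = card (hom B Z \<inter> extensional (carrier B))"
proof (rule bij_betw_same_card [symmetric])
  interpret c: group_hom G B c by (intro group_hom.intro group_hom_axioms.intro is_group B c)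
  show "bij_betw (\<lambda>\<psi>. restrict (\<psi> \<circ> c) (carrier G)) (hom B Z \<inter> extensional (carrier B))
     {\<phi> \<in> hom G Z \<inter> extensional (carrier G).
            \<forall>x\<in>carrier G. c x = \<one>\<^bsub>B\<^esub> \<longrightarrow> \<phi> x = \<one>\<^bsub>Z\<^esub>}"
    unfolding bij_betw_def
  proof
    show "inj_on (\<lambda>\<psi>. restrict (\<psi> \<circ> c) (carrier G)) (hom B Z \<inter> extensional (carrier B))"
    proof (rule inj_onI)
      fix \<psi> \<psi>' assume h: "\<psi> \<in> hom B Z \<inter> extensional (carrier B)"
        "\<psi>' \<in> hom B Z \<inter> extensional (carrier B)"
        and eq: "restrict (\<psi> \<circ> c) (carrier G) = restrict (\<psi>' \<circ> c) (carrier G)"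
      show "\<psi> = \<psi>'"
      proof (rule extensionalityI [of _ "carrier B"])
        fix b assume "b \<in> carrier B"
        then obtain x where "x \<in> carrier G" "b = c x" using c(2) by blast
        then show "\<psi> b = \<psi>' b" using fun_cong [OF eq, of x] by simp
      qed (use h in auto)
    qed
    show "(\<lambda>\<psi>. restrict (\<psi> \<circ> c) (carrier G)) ` (hom B Z \<inter> extensional (carrier B)) =
      {\<phi> \<in> hom G Z \<inter> extensional (carrier G).
            \<forall>x\<in>carrier G. c x = \<one>\<^bsub>B\<^esub> \<longrightarrow> \<phi> x = \<one>\<^bsub>Z\<^esub>}"
    proof (intro equalityI subsetI)
      fix \<phi> assume "\<phi> \<in> (\<lambda>\<psi>. restrict (\<psi> \<circ> c) (carrier G)) ` (hom B Z \<inter> extensional (carrier B))"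
      then obtain \<psi> where f: "\<psi> \<in> hom B Z" and p: "\<phi> = restrict (\<psi> \<circ> c) (carrier G)" by blast
      have "\<psi> \<one>\<^bsub>B\<^esub> = \<one>\<^bsub>Z\<^esub>" by (rule hom_one [OF f B Z])
      then show "\<phi> \<in> {\<phi> \<in> hom G Z \<inter> extensional (carrier G).
            \<forall>x\<in>carrier G. c x = \<one>\<^bsub>B\<^esub> \<longrightarrow> \<phi> x = \<one>\<^bsub>Z\<^esub>}"
        using f by (auto simp: p hom_def Pi_iff)
    next
      fix \<phi> assume "\<phi> \<in> {\<phi> \<in> hom G Z \<inter> extensional (carrier G).
            \<forall>x\<in>carrier G. c x = \<one>\<^bsub>B\<^esub> \<longrightarrow> \<phi> x = \<one>\<^bsub>Z\<^esub>}"
      then have f: "\<phi> \<in> hom G Z" "\<phi> \<in> extensional (carrier G)"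
        and ker: "\<And>x. x \<in> carrier G \<Longrightarrow> c x = \<one>\<^bsub>B\<^esub> \<Longrightarrow> \<phi> x = \<one>\<^bsub>Z\<^esub>" by auto
      interpret f: group_hom G Z \<phi> by (intro group_hom.intro group_hom_axioms.intro is_group Z f)
      define \<psi> where "\<psi> = (\<lambda>b\<in>carrier B. \<phi> (inv_into (carrier G) c b))"
      have \<psi>: "\<psi> (c x) = \<phi> x" if x: "x \<in> carrier G" for x
      proof -
        let ?x = "inv_into (carrier G) c (c x)"
        have "?x \<in> carrier G" "c ?x = c x" using x by (auto intro: inv_into_into f_inv_into_f)
        then have "\<phi> ?x = \<phi> x"
          using x ker [of "?x \<otimes> inv x"] c.eq_iff_diff_kernel [of ?x x] f.eq_iff_diff_kernel [of ?x x]
          by (metis inv_closed m_closed)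
        then show ?thesis using x by (simp add: \<psi>_def)
      qed
      have "\<psi> \<in> hom B Z"
      proof (rule homI)
        fix b assume "b \<in> carrier B"
        then obtain x where x: "x \<in> carrier G" "b = c x" using c(2) by blast
        then show "\<psi> b \<in> carrier Z" by (simp add: \<psi>)
        fix b' assume "b' \<in> carrier B"
        then obtain x' where x': "x' \<in> carrier G" "b' = c x'" using c(2) by blast
        show "\<psi> (b \<otimes>\<^bsub>B\<^esub> b') = \<psi> b \<otimes>\<^bsub>Z\<^esub> \<psi> b'"
          using x x' \<psi> [of "x \<otimes> x'"] by (simp add: \<psi>)
      qed
      moreover have "\<phi> = restrict (\<psi> \<circ> c) (carrier G)"
        using f(2) by (auto simp: \<psi> extensional_def fun_eq_iff)
      moreover have "\<psi> \<in> extensional (carrier B)" by (simp add: \<psi>_def)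
      ultimately show "\<phi> \<in> (\<lambda>\<psi>. restrict (\<psi> \<circ> c) (carrier G)) ` (hom B Z \<inter> extensional (carrier B))"
        by blast
    qed
  qed
qed

end

section \<open>Counting colorings and flows\<close>

text \<open>The indicator of avoiding all the conditions is the product of the factors 1 - [P e],
  which is expanded over subsets of E and summed over the finite set.\<close>

lemma card_avoiding_inclusion_exclusion:
  fixes P :: "'e \<Rightarrow> 'x \<Rightarrow> bool"
  assumes "finite \<Phi>" "finite E"
  shows "(of_nat (card {\<phi> \<in> \<Phi>. \<forall>e\<in>E. \<not> P e \<phi>}) :: 'r::comm_ring_1) =
    (\<Sum>A\<in>Pow E. (-1) ^ card A * of_nat (card {\<phi> \<in> \<Phi>. \<forall>e\<in>A. P e \<phi>}))"
proof -
  have prod: "(\<Prod>e\<in>A. of_bool (Q e) :: 'r) = of_bool (\<forall>e\<in>A. Q e)" if "finite A" for A and Q :: "'e \<Rightarrow> bool"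
    using that by (induction A) auto
  have "(of_nat (card {\<phi> \<in> \<Phi>. \<forall>e\<in>E. \<not> P e \<phi>}) :: 'r) = (\<Sum>\<phi>\<in>\<Phi>. of_bool (\<forall>e\<in>E. \<not> P e \<phi>))"
    using assms by (simp add: Int_def)
  also have "\<dots> = (\<Sum>\<phi>\<in>\<Phi>. \<Prod>e\<in>E. 1 - of_bool (P e \<phi>))"
    using assms(2) by (simp add: prod [symmetric] of_bool_not_iff)
  also have "\<dots> = (\<Sum>\<phi>\<in>\<Phi>. \<Sum>A\<in>Pow E. (-1) ^ card A * of_bool (\<forall>e\<in>A. P e \<phi>))"
    using assms(2) by (intro sum.cong refl) (auto simp: prod_diff_conv_sum prod finite_subset)
  also have "\<dots> = (\<Sum>A\<in>Pow E. (-1) ^ card A * (\<Sum>\<phi>\<in>\<Phi>. of_bool (\<forall>e\<in>A. P e \<phi>)))"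
    by (subst sum.swap) (simp add: sum_distrib_left)
  finally show ?thesis using assms by (simp add: Int_def)
qed

section \<open>Relations modulo q and the group G/qG\<close>

context comm_group
begin

text \<open>The relations are the kernel of the evaluation map from the group of functions A -> Z/q
  to G, whose image is the span of the f e. Evaluation is a homomorphism because G has exponent
  dividing q, so reducing a coefficient modulo q does not change a power.\<close>

lemma card_integer_mod_relations:
  assumes A: "finite A" "f \<in> A \<rightarrow> carrier G" and q: "q > 0" "\<And>x. x \<in> carrier G \<Longrightarrow> x [^] q = \<one>"
  shows "q ^ card A = card (generate G (f ` A)) *
    card {\<phi> \<in> A \<rightarrow>\<^sub>E carrier (integer_mod_group q). (\<Otimes>e\<in>A. f e [^] \<phi> e) = \<one>}"
proof -
  let ?Z = "integer_mod_group q" and ?P = "product_group A (\<lambda>_. integer_mod_group q)"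
  define h where "h = (\<lambda>\<phi>. \<Otimes>e\<in>A. f e [^] (\<phi> e :: int))"
  have modq: "x [^] (i mod int q) = x [^] i" if "x \<in> carrier G" for x and i :: int
  proof -
    have "x [^] i = x [^] (int q * (i div int q) + i mod int q)" by simp
    also have "\<dots> = (x [^] int q) [^] (i div int q) \<otimes> x [^] (i mod int q)"
      using that by (simp only: int_pow_mult int_pow_pow)
    finally show ?thesis using that q by (simp add: int_pow_int)
  qed
  have fe: "f e \<in> carrier G" if "e \<in> A" for e using A that by auto
  have "h \<in> hom ?P G"
  proof (rule homI)
    show "h \<phi> \<in> carrier G" for \<phi> unfolding h_def using fe by (intro finprod_closed) auto
    show "h (\<phi> \<otimes>\<^bsub>?P\<^esub> \<psi>) = h \<phi> \<otimes> h \<psi>" for \<phi> \<psi>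
    proof -
      have "h (\<phi> \<otimes>\<^bsub>?P\<^esub> \<psi>) = (\<Otimes>e\<in>A. f e [^] \<phi> e \<otimes> f e [^] \<psi> e)"
        unfolding h_def using fe by (intro finprod_cong') (auto simp: modq int_pow_mult)
      also have "\<dots> = h \<phi> \<otimes> h \<psi>" unfolding h_def using fe by (intro finprod_multf) auto
      finally show ?thesis .
    qed
  qed
  then interpret h: group_hom ?P G h
    by (intro group_hom.intro group_hom_axioms.intro is_group) auto
  have "h ` carrier ?P = generate G (f ` A)"
  proof (rule generateI)
    show "subgroup (h ` carrier ?P) G" by (rule h.img_is_subgroup)
    show "f ` A \<subseteq> h ` carrier ?P"
    proof clarify
      fix e assume e: "e \<in> A"
      \<comment> \<open>For q = 1 the only residue is 0; hence \<open>1 mod int q\<close> in place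
        of 1.\<close>
      let ?d = "\<lambda>e'\<in>A. if e' = e then 1 mod int q else 0"
      have "h ?d = (\<Otimes>e'\<in>A. if e' = e then f e' else \<one>)"
        unfolding h_def using fe modq [of _ 1] by (intro finprod_cong') auto
      also have "\<dots> = f e" using e A by (rule finprod_singleton_swap)
      finally show "f e \<in> h ` carrier ?P"
        using q by (intro image_eqI [of _ _ ?d]) (auto simp: carrier_integer_mod_group)
    qed
    show "h ` carrier ?P \<subseteq> K" if "subgroup K G" "f ` A \<subseteq> K" for K
      unfolding h_def using that
      by (auto intro!: finprod_in_subgroup subgroup_int_pow_closed)
  qed
  moreover have "finite (carrier ?P)"
    using A q by (auto simp: carrier_integer_mod_group intro!: finite_PiE)
  moreover have "card (carrier ?P) = q ^ card A"
    using A q by (simp add: carrier_integer_mod_group card_PiE)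
  ultimately show ?thesis using h.card_image_kernel by (simp add: h_def)
qed

lemma comm_group_mod_group: "comm_group (mod_group G q)"
  unfolding mod_group_def by (intro comm_group_Mod subgroup_multiples subgroup_self)

lemma mod_group_exponent:
  assumes "y \<in> carrier (mod_group G q)"
  shows "y [^]\<^bsub>mod_group G q\<^esub> q = \<one>\<^bsub>mod_group G q\<^esub>"
proof -
  let ?m = "multiples G (int q) (carrier G)"
  have m: "subgroup ?m G" by (intro subgroup_multiples subgroup_self)
  from assms obtain x where x: "x \<in> carrier G" "y = ?m #> x"
    by (auto simp: mod_group_def carrier_FactGroup)
  have "x [^] q \<in> ?m" using x by (auto simp: multiples_def int_pow_int [symmetric])
  then show ?thesis using x by (simp add: mod_group_def Mod_nat_pow [OF m] rcos_eq_self_iff [OF m])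
qed

lemma finite_torsion_kernel:
  assumes "finite U" "U \<subseteq> carrier G" "generate G U = carrier G" "q > 0"
  shows "finite {x \<in> carrier G. x [^] (q::nat) = \<one>}"
  by (rule finite_subset [OF _ finite_torsion_set [OF assms(1-3)]])
     (use assms(4) in \<open>auto simp: torsion_set_def\<close>)

lemma card_mod_group:
  assumes U: "finite U" "U \<subseteq> carrier G" "generate G U = carrier G" and q: "q > 0"
  shows "card (carrier (mod_group G q)) =
    q ^ abelian_rank G * card {x \<in> carrier G. x [^] q = \<one>}"
    and "finite (carrier (mod_group G q))"
proof -
  obtain S where S: "int_independent G S" "U \<subseteq> rad (generate G S)"
    using exists_independent_extension [OF int_independent_empty U(1,2)] by metis
  show eq: "card (carrier (mod_group G q)) = q ^ abelian_rank G * card {x \<in> carrier G. x [^] q = \<one>}"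
    using card_Mod_multiples [OF U S q] abelian_rank_eq [OF U S] by (simp add: mod_group_def)
  have "card {x \<in> carrier G. x [^] q = \<one>} > 0"
    using finite_torsion_kernel [OF U q] by (auto simp: card_gt_0_iff intro!: exI [of _ \<one>])
  with eq q have "card (carrier (mod_group G q)) > 0" by simp
  then show "finite (carrier (mod_group G q))" by (simp add: card_gt_0_iff)
qed

end

section \<open>Colorings and flows of a fixed list\<close>

locale abelian_list = comm_group G for G (structure) +
  fixes g :: "'e \<Rightarrow> 'a" and E :: "'e set" and U :: "'a set"
  assumes gen: "finite U" "U \<subseteq> carrier G" "generate G U = carrier G"
    and fin_E: "finite E" and g: "g \<in> E \<rightarrow> carrier G"
begin

abbreviation lspan :: "'e set \<Rightarrow> 'a set" where "lspan A \<equiv> generate G (g ` A)"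

lemma finite_sub: "A \<subseteq> E \<Longrightarrow> finite A"
  using fin_E by (rule finite_subset [rotated])

lemma g_sub: "A \<subseteq> E \<Longrightarrow> g \<in> A \<rightarrow> carrier G"
  using g by auto

lemma g_closed: "e \<in> E \<Longrightarrow> g e \<in> carrier G"
  using g by auto

lemma subgroup_span: "A \<subseteq> E \<Longrightarrow> subgroup (lspan A) G"
  using g by (intro generate_is_subgroup) auto

lemma comm_group_list_quotient: "A \<subseteq> E \<Longrightarrow> comm_group (list_quotient G g A)"
  unfolding list_quotient_def by (intro comm_group_Mod subgroup_span)

lemma list_quotient_generated:
  assumes "A \<subseteq> E"
  shows "finite ((\<lambda>x. lspan A #> x) ` U)" "(\<lambda>x. lspan A #> x) ` U \<subseteq> carrier (list_quotient G g A)"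
    "generate (list_quotient G g A) ((\<lambda>x. lspan A #> x) ` U) = carrier (list_quotient G g A)"
  using gen generate_Mod [OF subgroup_span [OF assms] gen(2,3)]
  by (auto simp: list_quotient_def carrier_FactGroup)

lemma torsion_ratio_eq:
  assumes A: "A \<subseteq> E" and "q > 0"
  shows "torsion_ratio G g (int q) A =
    of_nat (card {y \<in> carrier (list_quotient G g A). y [^]\<^bsub>list_quotient G g A\<^esub> q = \<one>\<^bsub>list_quotient G g A\<^esub>})"
    and "torsion_ratio G g (int q) A > 0"
proof -
  let ?H = "list_quotient G g A"
  interpret H: comm_group ?H by (rule comm_group_list_quotient [OF A])
  note U = list_quotient_generated [OF A]
  have fin: "finite (torsion_set ?H)" by (rule H.finite_torsion_set [OF U])
  moreover have "\<one>\<^bsub>?H\<^esub> \<in> torsion_set ?H" by (auto simp: torsion_set_def intro: exI [of _ 1])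
  ultimately have "card (multiples ?H (int q) (torsion_set ?H)) > 0"
    by (auto simp: multiples_def card_gt_0_iff)
  then show "torsion_ratio G g (int q) A = of_nat (card {y \<in> carrier ?H. y [^]\<^bsub>?H\<^esub> q = \<one>\<^bsub>?H\<^esub>})"
    using H.card_torsion_multiples [OF fin \<open>q > 0\<close>]
    by (simp add: torsion_ratio_def quotient_torsion_def)
  moreover have "card {y \<in> carrier ?H. y [^]\<^bsub>?H\<^esub> q = \<one>\<^bsub>?H\<^esub>} > 0"
    using H.finite_torsion_kernel [OF U \<open>q > 0\<close>]
    by (auto simp: card_gt_0_iff intro!: exI [of _ "\<one>\<^bsub>?H\<^esub>"])
  ultimately show "torsion_ratio G g (int q) A > 0" by simp
qed

lemma card_mod_group_list_quotient:
  assumes A: "A \<subseteq> E" and q: "q > 0"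
  shows "(of_nat (card (carrier (mod_group (list_quotient G g A) q))) :: rat) =
    of_nat q ^ (abelian_rank G - rk G g A) * torsion_ratio G g (int q) A"
  using comm_group.card_mod_group [OF comm_group_list_quotient [OF A] list_quotient_generated [OF A] q]
    abelian_rank_list_quotient [OF gen finite_sub [OF A] g_sub [OF A]]
  by (simp add: torsion_ratio_eq [OF A q])

text \<open>The composite G -> H -> H/qH with H = G/<L_A>. In additive terms its kernel is <L_A> +
  qG, so it presents the same group as a quotient of G by L_A and of G/qG by the image of
  L_A.\<close>

definition coset_map :: "'e set \<Rightarrow> nat \<Rightarrow> 'a \<Rightarrow> 'a set set" where
  "coset_map A q x =
     multiples (list_quotient G g A) (int q) (carrier (list_quotient G g A))
       #>\<^bsub>list_quotient G g A\<^esub> (lspan A #> x)"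

lemma coset_map:
  assumes A: "A \<subseteq> E"
  shows "coset_map A q \<in> hom G (mod_group (list_quotient G g A) q)"
    and "coset_map A q ` carrier G = carrier (mod_group (list_quotient G g A) q)"
    and "x \<in> carrier G \<Longrightarrow> coset_map A q x = \<one>\<^bsub>mod_group (list_quotient G g A) q\<^esub> \<longleftrightarrow>
          (\<exists>l\<in>lspan A. \<exists>y\<in>carrier G. x = l \<otimes> y [^] int q)"
proof -
  let ?H = "list_quotient G g A"
  interpret H: comm_group ?H by (rule comm_group_list_quotient [OF A])
  let ?m = "multiples ?H (int q) (carrier ?H)"
  have L: "subgroup (lspan A) G" by (rule subgroup_span [OF A])
  have m: "subgroup ?m ?H" by (intro H.subgroup_multiples H.subgroup_self)
  show "coset_map A q \<in> hom G (mod_group ?H q)"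
    using Group.hom_compose [OF rcos_hom [OF L] H.rcos_hom [OF m, unfolded list_quotient_def]]
    by (simp add: comp_def coset_map_def [abs_def] mod_group_def list_quotient_def)
  show "coset_map A q ` carrier G = carrier (mod_group ?H q)"
    by (auto simp: coset_map_def mod_group_def carrier_FactGroup list_quotient_def)
  show "coset_map A q x = \<one>\<^bsub>mod_group ?H q\<^esub> \<longleftrightarrow> (\<exists>l\<in>lspan A. \<exists>y\<in>carrier G. x = l \<otimes> y [^] int q)"
    if x: "x \<in> carrier G"
  proof -
    have Lx: "lspan A #> x \<in> carrier ?H"
      using x by (simp add: list_quotient_def carrier_FactGroup)
    have "coset_map A q x = \<one>\<^bsub>mod_group ?H q\<^esub> \<longleftrightarrow> lspan A #> x \<in> ?m"
      using H.rcos_eq_self_iff [OF m Lx] by (simp add: coset_map_def mod_group_def)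
    also have "\<dots> \<longleftrightarrow> (\<exists>y\<in>carrier G. lspan A #> x = lspan A #> (y [^] int q))"
      by (simp add: multiples_def list_quotient_def carrier_FactGroup image_image image_iff
            Mod_int_pow [OF L] cong: bex_cong)
    also have "\<dots> \<longleftrightarrow> (\<exists>y\<in>carrier G. x \<otimes> inv (y [^] int q) \<in> lspan A)"
      using x rcos_eq_iff [OF L x] by auto
    also have "\<dots> \<longleftrightarrow> (\<exists>l\<in>lspan A. \<exists>y\<in>carrier G. x = l \<otimes> y [^] int q)"
    proof (intro iffI; elim bexE)
      fix y assume y: "y \<in> carrier G" "x \<otimes> inv (y [^] int q) \<in> lspan A"
      then have "x = x \<otimes> inv (y [^] int q) \<otimes> y [^] int q" using x by (simp add: m_assoc)
      with y show "\<exists>l\<in>lspan A. \<exists>y\<in>carrier G. x = l \<otimes> y [^] int q" by blast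
    next
      fix l y assume ly: "l \<in> lspan A" "y \<in> carrier G" "x = l \<otimes> y [^] int q"
      then have "x \<otimes> inv (y [^] int q) \<in> lspan A"
        using subgroup.mem_carrier [OF L ly(1)] by (simp add: m_assoc)
      with ly(2) show "\<exists>y\<in>carrier G. x \<otimes> inv (y [^] int q) \<in> lspan A" by blast
    qed
    finally show ?thesis .
  qed
qed

lemma coset_map_lspan:
  assumes A: "A \<subseteq> E" and x: "x \<in> lspan A"
  shows "coset_map A q x = \<one>\<^bsub>mod_group (list_quotient G g A) q\<^esub>"
proof -
  have xc: "x \<in> carrier G" by (rule subgroup.mem_carrier [OF subgroup_span [OF A] x])
  then have "x = x \<otimes> \<one> [^] int q" by simp
  with x show ?thesis unfolding coset_map(3) [OF A xc] by blast
qed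

text \<open>A homomorphism into Z/q kills all q-th powers. Vanishing on L_A is therefore the same as
  vanishing on the kernel of \<open>coset_map\<close>, and such homomorphisms are those of H/qH, a
  finite group to which duality applies.\<close>

lemma card_homs_vanishing:
  assumes A: "A \<subseteq> E" and q: "q > 0"
  shows "card {\<phi> \<in> hom G (integer_mod_group q) \<inter> extensional (carrier G).
            \<forall>e\<in>A. \<phi> (g e) = \<one>\<^bsub>integer_mod_group q\<^esub>}
       = card (carrier (mod_group (list_quotient G g A) q))"
proof -
  let ?Z = "integer_mod_group q" and ?H = "list_quotient G g A"
  interpret H: comm_group ?H by (rule comm_group_list_quotient [OF A])
  interpret B: comm_group "mod_group ?H q" by (rule H.comm_group_mod_group)
  note c = coset_map [OF A, where q = q]
  have "(\<forall>e\<in>A. \<phi> (g e) = \<one>\<^bsub>?Z\<^esub>) \<longleftrightarrow>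
      (\<forall>x\<in>carrier G. coset_map A q x = \<one>\<^bsub>mod_group ?H q\<^esub> \<longrightarrow> \<phi> x = \<one>\<^bsub>?Z\<^esub>)" (is "?l \<longleftrightarrow> ?r")
    if f: "\<phi> \<in> hom G ?Z" for \<phi>
  proof
    interpret f: group_hom G ?Z \<phi>
      by (intro group_hom.intro group_hom_axioms.intro is_group f) simp
    assume ?l
    then have "lspan A \<subseteq> kernel G ?Z \<phi>"
      using A g_closed by (intro generate_subgroup_incl f.subgroup_kernel) (auto simp: kernel_def)
    moreover have "\<phi> (y [^] int q) = 0" if "y \<in> carrier G" for y
      using f.hom_int_pow [OF that, of "int q"] by (simp add: int_pow_integer_mod_group)
    ultimately show ?r
      using c(3) subgroup.mem_carrier [OF subgroup_span [OF A]] f.hom_mult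
      by (fastforce simp: kernel_def)
  next
    assume r: ?r
    show ?l
    proof
      fix e assume e: "e \<in> A"
      then have "g e \<in> lspan A" by (auto intro: generate.incl)
      then have "coset_map A q (g e) = \<one>\<^bsub>mod_group ?H q\<^esub>" by (rule coset_map_lspan [OF A])
      with r show "\<phi> (g e) = \<one>\<^bsub>?Z\<^esub>" using g_closed e A by auto
    qed
  qed
  then have "{\<phi> \<in> hom G ?Z \<inter> extensional (carrier G). \<forall>e\<in>A. \<phi> (g e) = \<one>\<^bsub>?Z\<^esub>} =
    {\<phi> \<in> hom G ?Z \<inter> extensional (carrier G).
       \<forall>x\<in>carrier G. coset_map A q x = \<one>\<^bsub>mod_group ?H q\<^esub> \<longrightarrow> \<phi> x = \<one>\<^bsub>?Z\<^esub>}"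
    by blast
  also have "card \<dots> = card (hom (mod_group ?H q) ?Z \<inter> extensional (carrier (mod_group ?H q)))"
    by (rule card_hom_factor [OF c(1,2)]) (simp_all add: B.is_group)
  also have "\<dots> = card (carrier (mod_group ?H q))"
    by (rule B.card_hom_integer_mod [OF H.card_mod_group(2) [OF list_quotient_generated [OF A] q] q
          H.mod_group_exponent])
  finally show ?thesis .
qed

definition edge_class :: "nat \<Rightarrow> 'e \<Rightarrow> 'a set" where
  "edge_class q e = multiples G (int q) (carrier G) #> g e"

lemma edge_class_closed: "e \<in> E \<Longrightarrow> edge_class q e \<in> carrier (mod_group G q)"
  using g_closed by (auto simp: edge_class_def mod_group_def carrier_FactGroup)

text \<open>\<open>coset_map\<close> factors through G/qG, and the kernel there is the image of
  <L_A>, which is spanned by the edge classes. So the index of their span in G/qG is |H/qH|.\<close>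

lemma card_mod_group_factor:
  assumes A: "A \<subseteq> E" and q: "q > 0"
  shows "card (carrier (mod_group G q)) =
    card (carrier (mod_group (list_quotient G g A) q)) *
    card (generate (mod_group G q) (edge_class q ` A))"
proof -
  let ?H = "list_quotient G g A" and ?m = "multiples G (int q) (carrier G)"
  interpret H: comm_group ?H by (rule comm_group_list_quotient [OF A])
  interpret B: comm_group "mod_group ?H q" by (rule H.comm_group_mod_group)
  note c = coset_map [OF A, where q = q]
  have L: "subgroup (lspan A) G" by (rule subgroup_span [OF A])
  have m: "subgroup ?m G" by (intro subgroup_multiples subgroup_self)
  interpret p: group_hom G "G Mod ?m" "\<lambda>x. ?m #> x" by (rule rcos_group_hom [OF m])
  have "generate (mod_group G q) (edge_class q ` A) = (\<lambda>x. ?m #> x) ` lspan A"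
    using p.generate_img [of "g ` A"] A g_closed
    by (auto simp: mod_group_def edge_class_def image_image)
  also have "\<dots> = (\<lambda>x. ?m #> x) ` {x \<in> carrier G. coset_map A q x = \<one>\<^bsub>mod_group ?H q\<^esub>}"
  proof (intro equalityI subsetI)
    fix z assume "z \<in> (\<lambda>x. ?m #> x) ` lspan A"
    then obtain x where x: "x \<in> lspan A" "z = ?m #> x" by blast
    then have xc: "x \<in> carrier G" using subgroup.mem_carrier [OF L] by blast
    have "coset_map A q x = \<one>\<^bsub>mod_group ?H q\<^esub>" by (rule coset_map_lspan [OF A x(1)])
    then show "z \<in> (\<lambda>x. ?m #> x) ` {x \<in> carrier G. coset_map A q x = \<one>\<^bsub>mod_group ?H q\<^esub>}"
      using x xc by blast
  next
    fix z assume "z \<in> (\<lambda>x. ?m #> x) ` {x \<in> carrier G. coset_map A q x = \<one>\<^bsub>mod_group ?H q\<^esub>}"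
    then obtain x where x: "x \<in> carrier G" "coset_map A q x = \<one>\<^bsub>mod_group ?H q\<^esub>" "z = ?m #> x"
      by blast
    then obtain l y where ly: "l \<in> lspan A" "y \<in> carrier G" "x = l \<otimes> y [^] int q"
      using c(3) by blast
    have lc: "l \<in> carrier G" using subgroup.mem_carrier [OF L ly(1)] .
    have "x \<otimes> inv l = y [^] int q" using ly(2) lc by (simp add: ly(3) m_comm [of l] m_assoc)
    then have "x \<otimes> inv l \<in> ?m" using ly by (auto simp: multiples_def)
    then have "z = ?m #> l" using rcos_eq_iff [OF m x(1) lc] x by simp
    then show "z \<in> (\<lambda>x. ?m #> x) ` lspan A" using ly by blast
  qed
  finally have gen_eq: "generate (mod_group G q) (edge_class q ` A) = \<dots>" .
  have "coset_map A q x = \<one>\<^bsub>mod_group ?H q\<^esub>" if x: "x \<in> ?m" for x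
  proof -
    from x obtain y where "y \<in> carrier G" "x = y [^] int q" by (auto simp: multiples_def)
    then have "x \<in> carrier G" "x = \<one> \<otimes> y [^] int q" by auto
    then show ?thesis
      using c(3) [of x] subgroup.one_closed [OF L] \<open>y \<in> carrier G\<close> by blast
  qed
  from card_Mod_image_kernel [OF m B.is_group c(1) this]
    card_mod_group(2) [OF gen q, unfolded mod_group_def]
  show ?thesis unfolding gen_eq unfolding c(2) mod_group_def by blast
qed

lemma rk_empty [simp]: "rk G g {} = 0"
  using rk_le_card [of "{}" g] by simp

text \<open>Let I be the size of the span of the edge classes. Then the number N of flows satisfies
  q^|A| = I N, while |G/qG| = |H/qH| I. Eliminating I gives N = q^|A| |H/qH| / |G/qG|, and the
  powers of q combine to the nullity of A.\<close>

lemma card_flows: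
  assumes A: "A \<subseteq> E" and q: "q > 0"
  shows "(of_nat (card {\<phi> \<in> A \<rightarrow>\<^sub>E carrier (integer_mod_group q).
            (\<Otimes>\<^bsub>mod_group G q\<^esub>e\<in>A. edge_class q e [^]\<^bsub>mod_group G q\<^esub> \<phi> e) = \<one>\<^bsub>mod_group G q\<^esub>}) :: rat) =
    of_nat q ^ (card A - rk G g A) * torsion_ratio G g (int q) A / torsion_ratio G g (int q) {}"
proof -
  let ?F = "mod_group G q"
  interpret F: comm_group ?F by (rule comm_group_mod_group)
  define N where "N = card {\<phi> \<in> A \<rightarrow>\<^sub>E carrier (integer_mod_group q).
            (\<Otimes>\<^bsub>?F\<^esub>e\<in>A. edge_class q e [^]\<^bsub>?F\<^esub> \<phi> e) = \<one>\<^bsub>?F\<^esub>}"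
  define I where "I = card (generate ?F (edge_class q ` A))"
  define r where "r = torsion_ratio G g (int q)"
  have "q ^ card A = I * N"
    unfolding I_def N_def using A edge_class_closed
    by (intro F.card_integer_mod_relations finite_sub q mod_group_exponent) auto
  then have 1: "(of_nat q :: rat) ^ card A = of_nat I * of_nat N"
    by (metis of_nat_mult of_nat_power)
  have 2: "(of_nat (card (carrier ?F)) :: rat) =
      of_nat q ^ (abelian_rank G - rk G g A) * r A * of_nat I"
    using card_mod_group_factor [OF A q] card_mod_group_list_quotient [OF A q]
    by (simp add: I_def r_def)
  \<comment> \<open>The case of the empty set, where the edge classes span the trivial group. It is
    the source of the denominator \<open>torsion_ratio G g (int q) {}\<close>.\<close>
  have 3: "(of_nat (card (carrier ?F)) :: rat) = of_nat q ^ abelian_rank G * r {}"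
    using card_mod_group_factor [of "{}", OF _ q] card_mod_group_list_quotient [of "{}", OF _ q]
    by (simp add: r_def F.generate_empty)
  have r0: "r {} > 0" using torsion_ratio_eq(2) [of "{}", OF _ q] by (simp add: r_def)
  have rG: "rk G g A \<le> abelian_rank G"
    by (rule abelian_rank_list_quotient(2) [OF gen finite_sub [OF A] g_sub [OF A]])
  have rA: "rk G g A \<le> card A" by (rule rk_le_card [OF finite_sub [OF A] g_sub [OF A]])
  have q0: "(of_nat q :: rat) \<noteq> 0" using q by simp
  have "of_nat q ^ abelian_rank G * r {} * of_nat N =
      of_nat q ^ (abelian_rank G - rk G g A) * r A * of_nat q ^ card A"
    using 1 2 3 by (metis mult.assoc)
  also have "of_nat q ^ card A = (of_nat q :: rat) ^ rk G g A * of_nat q ^ (card A - rk G g A)"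
    using rA by (simp flip: power_add)
  also have "of_nat q ^ (abelian_rank G - rk G g A) * r A * (of_nat q ^ rk G g A * of_nat q ^ (card A - rk G g A))
     = (of_nat q ^ (abelian_rank G - rk G g A) * of_nat q ^ rk G g A) * (r A * of_nat q ^ (card A - rk G g A))"
    by (simp add: mult_ac)
  also have "of_nat q ^ (abelian_rank G - rk G g A) * of_nat q ^ rk G g A = (of_nat q :: rat) ^ abelian_rank G"
    using rG by (simp flip: power_add)
  finally have "r {} * of_nat N = r A * of_nat q ^ (card A - rk G g A)"
    using q0 by (simp add: mult.assoc)
  then show ?thesis using r0 by (simp add: N_def [symmetric] r_def [symmetric] field_simps)
qed

lemma card_flows_vanishing:
  assumes A: "A \<subseteq> E" and q: "q > 0"
  shows "card {\<phi> \<in> E \<rightarrow>\<^sub>E carrier (integer_mod_group q).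
            (\<Otimes>\<^bsub>mod_group G q\<^esub>e\<in>E. edge_class q e [^]\<^bsub>mod_group G q\<^esub> \<phi> e) = \<one>\<^bsub>mod_group G q\<^esub> \<and>
            (\<forall>e\<in>E - A. \<phi> e = 0)} =
    card {\<phi> \<in> A \<rightarrow>\<^sub>E carrier (integer_mod_group q).
            (\<Otimes>\<^bsub>mod_group G q\<^esub>e\<in>A. edge_class q e [^]\<^bsub>mod_group G q\<^esub> \<phi> e) = \<one>\<^bsub>mod_group G q\<^esub>}"
    (is "card ?L = card ?R")
proof (rule bij_betw_same_card)
  let ?F = "mod_group G q"
  interpret F: comm_group ?F by (rule comm_group_mod_group)
  have prod: "(\<Otimes>\<^bsub>?F\<^esub>e\<in>E. edge_class q e [^]\<^bsub>?F\<^esub> \<phi> e) = (\<Otimes>\<^bsub>?F\<^esub>e\<in>A. edge_class q e [^]\<^bsub>?F\<^esub> \<psi> e)"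
    if "\<forall>e\<in>E - A. \<phi> e = 0" "\<forall>e\<in>A. \<phi> e = \<psi> e" for \<phi> \<psi> :: "'e \<Rightarrow> int"
    using that A fin_E edge_class_closed
    by (intro F.finprod_mono_neutral_cong_right) (auto intro!: F.int_pow_closed)
  show "bij_betw (\<lambda>\<phi>. restrict \<phi> A) ?L ?R"
    unfolding bij_betw_def
  proof
    show "inj_on (\<lambda>\<phi>. restrict \<phi> A) ?L"
    proof (rule inj_onI)
      fix \<phi> \<psi> assume h: "\<phi> \<in> ?L" "\<psi> \<in> ?L" "restrict \<phi> A = restrict \<psi> A"
      have "\<phi> e = \<psi> e" if "e \<in> E" for e
      proof (cases "e \<in> A")
        case True
        then show ?thesis using fun_cong [OF h(3), of e] by simp
      next
        case False
        then show ?thesis using h(1,2) that by simp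
      qed
      then show "\<phi> = \<psi>" using h by (intro PiE_ext [of _ E _ \<psi>]) auto
    qed
    show "(\<lambda>\<phi>. restrict \<phi> A) ` ?L = ?R"
    proof (intro equalityI subsetI)
      fix \<psi> assume "\<psi> \<in> (\<lambda>\<phi>. restrict \<phi> A) ` ?L"
      then obtain \<phi> where \<phi>: "\<phi> \<in> ?L" and \<psi>: "\<psi> = restrict \<phi> A" by blast
      then show "\<psi> \<in> ?R" using prod [of \<phi> \<psi>] A by auto
    next
      fix \<psi> assume \<psi>: "\<psi> \<in> ?R"
      let ?\<phi> = "\<lambda>e\<in>E. if e \<in> A then \<psi> e else 0"
      have "\<psi> = restrict ?\<phi> A" using \<psi> A by (intro PiE_ext [of _ A _ "restrict ?\<phi> A"]) auto
      moreover have "(\<Otimes>\<^bsub>?F\<^esub>e\<in>E. edge_class q e [^]\<^bsub>?F\<^esub> ?\<phi> e) = (\<Otimes>\<^bsub>?F\<^esub>e\<in>A. edge_class q e [^]\<^bsub>?F\<^esub> \<psi> e)"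
        using A by (intro prod) auto
      then have "?\<phi> \<in> ?L" using \<psi> by auto
      ultimately show "\<psi> \<in> (\<lambda>\<phi>. restrict \<phi> A) ` ?L" by (rule image_eqI)
    qed
  qed
qed

section \<open>Colorings and flows as alternating sums\<close>

lemma chi_expansion:
  assumes q: "q > 0"
  shows "(of_nat (chi G g E q) :: rat) =
    (\<Sum>A\<in>Pow E. (-1) ^ card A * (of_nat q ^ (abelian_rank G - rk G g A) * torsion_ratio G g (int q) A))"
proof -
  let ?Z = "integer_mod_group q"
  let ?X = "hom G ?Z \<inter> extensional (carrier G)"
  interpret H: comm_group "list_quotient G g {}" by (rule comm_group_list_quotient) simp
  interpret B: comm_group "mod_group (list_quotient G g {}) q" by (rule H.comm_group_mod_group)
  \<comment> \<open>G may be infinite, so finiteness of the set of all homomorphisms is not evident.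
    It follows from the count for the empty set, which is positive.\<close>
  have "card (carrier (mod_group (list_quotient G g {}) q)) > 0"
    using H.card_mod_group(2) [OF list_quotient_generated q] B.one_closed
    by (auto simp: card_gt_0_iff)
  moreover have "card ?X = card (carrier (mod_group (list_quotient G g {}) q))"
    using card_homs_vanishing [of "{}", OF _ q] by (simp add: Int_def)
  ultimately have "finite ?X" by (metis card_ge_0_finite)
  from card_avoiding_inclusion_exclusion [OF this fin_E, where P = "\<lambda>e \<phi>. \<phi> (g e) = \<one>\<^bsub>?Z\<^esub>"]
  have "(of_nat (chi G g E q) :: rat) =
      (\<Sum>A\<in>Pow E. (-1) ^ card A * of_nat (card {\<phi> \<in> ?X. \<forall>e\<in>A. \<phi> (g e) = \<one>\<^bsub>?Z\<^esub>}))"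
    by (simp add: chi_def proper_colorings_def)
  also have "\<dots> = (\<Sum>A\<in>Pow E. (-1) ^ card A *
      (of_nat q ^ (abelian_rank G - rk G g A) * torsion_ratio G g (int q) A))"
    using card_homs_vanishing [OF _ q] card_mod_group_list_quotient [OF _ q]
    by (intro sum.cong refl) simp
  finally show ?thesis .
qed

lemma chi_star_expansion:
  assumes q: "q > 0"
  shows "(of_nat (chi_star G g E q) :: rat) =
    (\<Sum>A\<in>Pow E. (-1) ^ (card E - card A) *
      (of_nat q ^ (card A - rk G g A) * torsion_ratio G g (int q) A / torsion_ratio G g (int q) {}))"
proof -
  let ?Z = "integer_mod_group q" and ?F = "mod_group G q"
  let ?X = "{\<phi> \<in> E \<rightarrow>\<^sub>E carrier ?Z. (\<Otimes>\<^bsub>?F\<^esub>e\<in>E. edge_class q e [^]\<^bsub>?F\<^esub> \<phi> e) = \<one>\<^bsub>?F\<^esub>}"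
  have "finite (E \<rightarrow>\<^sub>E carrier ?Z)"
    using fin_E q by (intro finite_PiE) (auto simp: carrier_integer_mod_group)
  then have "finite ?X" by simp
  note ie = card_avoiding_inclusion_exclusion [OF this fin_E, where P = "\<lambda>e \<phi>. \<phi> e = (0::int)"]
  have "nowhere_zero_flows G g E q = {\<phi> \<in> ?X. \<forall>e\<in>E. \<not> \<phi> e = 0}"
    by (auto simp: nowhere_zero_flows_def edge_class_def PiE_iff)
  then have "(of_nat (chi_star G g E q) :: rat) =
      (\<Sum>A\<in>Pow E. (-1) ^ card A * of_nat (card {\<phi> \<in> ?X. \<forall>e\<in>A. \<phi> e = 0}))"
    using ie by (simp add: chi_star_def)
  \<comment> \<open>Inclusion-exclusion runs over sets of edges where a flow is zero. Passing to
    complements makes A a set containing the support.\<close>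
  also have "\<dots> = (\<Sum>A\<in>Pow E. (-1) ^ card (E - A) * of_nat (card {\<phi> \<in> ?X. \<forall>e\<in>E - A. \<phi> e = 0}))"
    by (rule sum.reindex_bij_witness [where i = "\<lambda>A. E - A" and j = "\<lambda>A. E - A"])
       (auto simp: double_diff)
  also have "\<dots> = (\<Sum>A\<in>Pow E. (-1) ^ (card E - card A) *
      (of_nat q ^ (card A - rk G g A) * torsion_ratio G g (int q) A / torsion_ratio G g (int q) {}))"
    using card_flows_vanishing [OF _ q] card_flows [OF _ q]
    by (intro sum.cong refl) (simp add: card_Diff_subset finite_sub)
  finally show ?thesis .
qed

section \<open>Bases and the torsion ratio at special moduli\<close>

text \<open>Extend a basis C of A to a basis B of E. An element of <L_B> that lies in the radical of
  <L_A>, hence in that of <L_C>, has zero coefficients off C, so it belongs to <L_A>. Thus rad <L_A>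
  modulo its intersection with <L_B> embeds into the torsion of G/<L_B> and maps onto that of
  G/<L_A>.\<close>

lemma exists_basis:
  assumes A: "A \<subseteq> E"
  obtains B where "B \<in> bases G g E" "B \<subseteq> E" "rad (lspan A) \<subseteq> rad (lspan B)"
    "rad (lspan A) \<inter> lspan B \<subseteq> lspan A"
proof -
  obtain C where C: "C \<subseteq> A" "inj_on g C" "int_independent G (g ` C)"
    "g ` A \<subseteq> rad (lspan C)"
    using exists_index_basis [OF finite_sub [OF A] g_sub [OF A], of "{}"] by auto
  have CE: "C \<subseteq> E" using C A by blast
  obtain B where B: "C \<subseteq> B" "B \<subseteq> E" "inj_on g B" "int_independent G (g ` B)"
    "g ` E \<subseteq> rad (lspan B)"
    using exists_index_basis [OF fin_E g CE C(2,3)] by blast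
  have rB: "rk G g B = card B" "rk G g E = card B"
  proof -
    have "g ` B \<subseteq> rad (lspan B)" using B(2,5) by blast
    then show "rk G g B = card B"
      using rk_eq_card [OF finite_sub [OF B(2)] g_sub [OF B(2)], of B] B(3,4) by simp
    show "rk G g E = card B" by (rule rk_eq_card [OF fin_E g B(2-5)])
  qed
  have "B \<in> bases G g E"
    unfolding bases_def indep_def
  proof (intro CollectI conjI allI impI)
    fix D assume D: "(D \<subseteq> E \<and> rk G g D = card D) \<and> B \<subseteq> D"
    then have "card D \<le> card B" using rk_mono [OF fin_E g, of D] rB by simp
    with D show "D = B" using card_seteq [of D B] finite_sub by blast
  qed (use B rB in auto)
  moreover have AC: "lspan A \<subseteq> rad (lspan C)" by (rule generate_le_rad [OF subgroup_span [OF CE] C(4)])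
  have rAC: "rad (lspan A) \<subseteq> rad (lspan C)"
    using rad_mono [OF AC] rad_rad [of "lspan C"] by blast
  have CB: "lspan C \<subseteq> lspan B" using B(1) by (intro mono_generate) auto
  have "rad (lspan A) \<subseteq> rad (lspan B)"
    using rAC rad_mono [OF CB] by blast
  moreover have "rad (lspan A) \<inter> lspan B \<subseteq> lspan A"
  proof
    fix x assume x: "x \<in> rad (lspan A) \<inter> lspan B"
    have gB: "finite (g ` B)" "g ` B \<subseteq> carrier G" using B(4) by (auto simp: int_independent_iff)
    then obtain c where c: "x = comb (g ` B) c" using x by (auto simp: generate_eq_range_comb)
    have "comb (g ` B) c \<in> rad (lspan C)" using x rAC c by blast
    then have "c s = 0" if "s \<in> g ` B - g ` C" for s
      using comb_coeff_eq_zero [OF B(4) image_mono [OF B(1)]] that by blast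
    then have "x = comb (g ` C) c"
      unfolding c using gB B(1) by (intro comb_extend) auto
    also have "\<dots> \<in> lspan A"
      using C(1)
      by (intro comb_in_subgroup [OF subgroup_span [OF A]]) (auto intro: generate.incl)
    finally show "x \<in> lspan A" .
  qed
  ultimately show thesis using that B(2) by blast
qed

lemma quotient_torsion_eq:
  assumes A: "A \<subseteq> E"
  shows "quotient_torsion G g A = (\<lambda>x. lspan A #> x) ` rad (lspan A)"
  using Mod_nat_pow [OF subgroup_span [OF A]] rcos_eq_self_iff [OF subgroup_span [OF A]]
  by (auto simp: quotient_torsion_def torsion_set_def list_quotient_def carrier_FactGroup rad_def
        intro!: imageI)

lemma one_quotient_torsion:
  assumes A: "A \<subseteq> E"
  shows "lspan A \<in> quotient_torsion G g A"
proof -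
  have "\<one> \<in> rad (lspan A)"
    using subgroup.one_closed [OF subgroup_rad [OF subgroup_span [OF A]]] .
  moreover have "lspan A #> \<one> = lspan A"
    using subgroup.subset [OF subgroup_span [OF A]] by simp
  ultimately show ?thesis unfolding quotient_torsion_eq [OF A] by (metis image_eqI)
qed

text \<open>If q kills the torsion of G/<L_B>, it sends rad <L_A> into <L_B>, hence into <L_A> by
  the choice of B. So q kills the torsion of G/<L_A>, and the denominator of the ratio is 1.\<close>

lemma torsion_ratio_Z_A:
  assumes A: "A \<subseteq> E" and q: "q \<in> Z_A G g E"
  shows "torsion_ratio G g (int q) A = of_nat (arith_mult G g A)"
proof -
  let ?H = "list_quotient G g A"
  obtain B where B: "B \<in> bases G g E" "B \<subseteq> E" "rad (lspan A) \<subseteq> rad (lspan B)"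
    "rad (lspan A) \<inter> lspan B \<subseteq> lspan A"
    using exists_basis [OF A] .
  note LA = subgroup_span [OF A] and LB = subgroup_span [OF B(2)]
  have "x [^] int q \<in> lspan A" if x: "x \<in> rad (lspan A)" for x
  proof -
    have xc: "x \<in> carrier G" using x by (simp add: rad_def)
    have "lspan B #> x \<in> quotient_torsion G g B"
      using x B(3) by (auto simp: quotient_torsion_eq [OF B(2)])
    then have "(lspan B #> x) [^]\<^bsub>list_quotient G g B\<^esub> int q \<in>
        multiples (list_quotient G g B) (int q) (quotient_torsion G g B)"
      unfolding multiples_def by (rule imageI)
    then have "lspan B #> (x [^] int q) = lspan B"
      using q B(1) xc by (auto simp: Z_A_def list_quotient_def Mod_int_pow [OF LB])
    then have "x [^] int q \<in> lspan B" using rcos_eq_self_iff [OF LB] xc by simp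
    moreover have "x [^] int q \<in> rad (lspan A)"
      by (rule subgroup_int_pow_closed [OF subgroup_rad [OF LA] x])
    ultimately show ?thesis using B(4) by blast
  qed
  then have "(lspan A #> x) [^]\<^bsub>?H\<^esub> int q = lspan A" if "x \<in> rad (lspan A)" for x
    using that rcos_eq_self_iff [OF LA]
    by (simp add: list_quotient_def Mod_int_pow [OF LA] rad_def)
  then have "multiples ?H (int q) (quotient_torsion G g A) \<subseteq> {lspan A}"
    by (auto simp: multiples_def quotient_torsion_eq [OF A])
  moreover have "multiples ?H (int q) (quotient_torsion G g A) \<noteq> {}"
    using one_quotient_torsion [OF A] by (auto simp: multiples_def)
  ultimately have "multiples ?H (int q) (quotient_torsion G g A) = {lspan A}" by blast
  then show ?thesis by (simp add: torsion_ratio_def arith_mult_def)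
qed

text \<open>An element of a finite group is killed by the order of the group, here for the torsion
  of G/<L_B>, of order m(B).\<close>

lemma pow_arith_mult:
  assumes B: "B \<subseteq> E" and x: "x \<in> rad (lspan B)"
  shows "x [^] arith_mult G g B \<in> lspan B"
proof -
  let ?H = "list_quotient G g B"
  interpret H: comm_group ?H by (rule comm_group_list_quotient [OF B])
  let ?T = "?H\<lparr>carrier := torsion_set ?H\<rparr>"
  have xc: "x \<in> carrier G" using x by (simp add: rad_def)
  interpret T: comm_group ?T by (rule H.comm_group_subgroup [OF H.subgroup_torsion_set])
  have "lspan B #> x \<in> torsion_set ?H"
    using x quotient_torsion_eq [OF B] by (auto simp: quotient_torsion_def)
  then have "(lspan B #> x) [^]\<^bsub>?T\<^esub> card (torsion_set ?H) = \<one>\<^bsub>?T\<^esub>"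
    using T.power_order_eq_one H.finite_torsion_set [OF list_quotient_generated [OF B]] by simp
  then have "(lspan B #> x) [^]\<^bsub>?H\<^esub> arith_mult G g B = lspan B"
    by (simp add: arith_mult_def quotient_torsion_def list_quotient_def
          flip: H.nat_pow_consistent [unfolded list_quotient_def])
  then show ?thesis
    using xc rcos_eq_self_iff [OF subgroup_span [OF B]]
    by (simp add: list_quotient_def Mod_nat_pow [OF subgroup_span [OF B]])
qed

text \<open>If the q-th power of x is in <L_A>, then so is its m(B)-th power, by the choice of B. As
  q and m(B) are coprime, Bezout puts x itself into <L_A>. So G/<L_A> has no nontrivial
  q-torsion.\<close>

lemma torsion_ratio_Z_M:
  assumes A: "A \<subseteq> E" and q: "q \<in> Z_M G g E"
  shows "torsion_ratio G g (int q) A = 1"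
proof -
  let ?H = "list_quotient G g A"
  have "q > 0" using q by (simp add: Z_M_def)
  obtain B where B: "B \<in> bases G g E" "B \<subseteq> E" "rad (lspan A) \<subseteq> rad (lspan B)"
    "rad (lspan A) \<inter> lspan B \<subseteq> lspan A"
    using exists_basis [OF A] .
  let ?m = "arith_mult G g B"
  note LA = subgroup_span [OF A]
  have "?m dvd Lcm (arith_mult G g ` bases G g E)" using B(1) by (intro dvd_Lcm) auto
  moreover have "coprime q (Lcm (arith_mult G g ` bases G g E))"
    using q by (simp add: Z_M_def coprime_iff_gcd_eq_1)
  ultimately have "coprime q ?m" using coprime_divisors dvd_refl by blast
  then have "gcd (int q) (int ?m) = 1" by (simp add: coprime_iff_gcd_eq_1)
  then obtain u v where uv: "u * int q + v * int ?m = 1"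
    using bezout_int [of "int q" "int ?m"] by metis
  have triv: "x \<in> lspan A" if x: "x \<in> carrier G" "x [^] q \<in> lspan A" for x
  proof -
    have xr: "x \<in> rad (lspan A)" using x \<open>q > 0\<close> by (auto simp: rad_def)
    have "x [^] ?m \<in> rad (lspan A)" by (rule subgroup_nat_pow_closed [OF subgroup_rad [OF LA] xr])
    moreover have "x [^] ?m \<in> lspan B" using pow_arith_mult [OF B(2)] xr B(3) by blast
    ultimately have "x [^] ?m \<in> lspan A" using B(4) by blast
    with x have "x [^] int ?m \<in> lspan A" "x [^] int q \<in> lspan A" by (simp_all add: int_pow_int)
    then have "(x [^] int q) [^] u \<otimes> (x [^] int ?m) [^] v \<in> lspan A"
      by (simp add: subgroup.m_closed [OF LA] subgroup_int_pow_closed [OF LA] del: int_pow_closed)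
    also have "(x [^] int q) [^] u \<otimes> (x [^] int ?m) [^] v = x [^] (u * int q + v * int ?m)"
      using x by (simp only: int_pow_pow int_pow_mult mult.commute)
    finally show ?thesis using x by (simp add: uv)
  qed
  have "{y \<in> carrier ?H. y [^]\<^bsub>?H\<^esub> q = \<one>\<^bsub>?H\<^esub>} = {\<one>\<^bsub>?H\<^esub>}"
  proof (intro equalityI subsetI)
    fix y assume y: "y \<in> {y \<in> carrier ?H. y [^]\<^bsub>?H\<^esub> q = \<one>\<^bsub>?H\<^esub>}"
    then obtain x where x: "x \<in> carrier G" "y = lspan A #> x"
      by (auto simp: list_quotient_def carrier_FactGroup)
    with y have "x [^] q \<in> lspan A"
      using rcos_eq_self_iff [OF LA, of "x [^] q"] by (simp add: list_quotient_def Mod_nat_pow [OF LA])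
    with x show "y \<in> {\<one>\<^bsub>?H\<^esub>}"
      using triv rcos_eq_self_iff [OF LA] by (simp add: list_quotient_def)
  next
    interpret H: comm_group ?H by (rule comm_group_list_quotient [OF A])
    fix y assume "y \<in> {\<one>\<^bsub>?H\<^esub>}"
    then show "y \<in> {y \<in> carrier ?H. y [^]\<^bsub>?H\<^esub> q = \<one>\<^bsub>?H\<^esub>}" by simp
  qed
  then show ?thesis by (simp add: torsion_ratio_eq(1) [OF A \<open>q > 0\<close>])
qed

section \<open>Comparison with the Tutte sums\<close>

lemma chi_eq:
  assumes q: "q > 0"
  shows "(of_nat (chi G g E q) :: rat) =
    (-1) ^ rk G g E * of_nat q ^ (abelian_rank G - rk G g E) * tutte_quasi_poly G g E (1 - int q) 0"
proof -
  have "(-1) ^ card A * (of_nat q ^ (abelian_rank G - rk G g A) * torsion_ratio G g (int q) A) =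
      (-1) ^ rk G g E * of_nat q ^ (abelian_rank G - rk G g E) *
      (torsion_ratio G g (int q) A * (- of_nat q) ^ (rk G g E - rk G g A) * (- 1 :: rat) ^ (card A - rk G g A))"
    if "A \<in> Pow E" for A
  proof -
    have A: "A \<subseteq> E" using that by simp
    \<comment> \<open>Truncated differences are replaced by honest sums. The sign then works out
      because |A| and rk(E) + i + j differ by 2 i.\<close>
    obtain i where i: "rk G g E = rk G g A + i" using rk_mono [OF fin_E g A] le_Suc_ex by blast
    obtain j where j: "card A = rk G g A + j"
      using rk_le_card [OF finite_sub [OF A] g_sub [OF A]] le_Suc_ex by blast
    obtain k where k: "abelian_rank G = rk G g E + k"
      using abelian_rank_list_quotient(2) [OF gen fin_E g] le_Suc_ex by blast
    show ?thesis
      by (simp add: i j k power_add power_minus [of "of_nat q"] mult_ac)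
  qed
  then show ?thesis
    unfolding chi_expansion [OF q] tutte_quasi_poly_def sum_distrib_left
    by (intro sum.cong refl) simp
qed

lemma chi_star_eq:
  assumes q: "q > 0"
  shows "(of_nat (chi_star G g E q) :: rat) =
    (-1) ^ (card E - rk G g E) * inverse (torsion_ratio G g (int q) {}) *
      tutte_quasi_poly G g E 0 (1 - int q)"
proof -
  have "(-1) ^ (card E - card A) *
      (of_nat q ^ (card A - rk G g A) * torsion_ratio G g (int q) A / torsion_ratio G g (int q) {}) =
      (-1) ^ (card E - rk G g E) * inverse (torsion_ratio G g (int q) {}) *
      (torsion_ratio G g (int q) A * (- 1 :: rat) ^ (rk G g E - rk G g A) * (- of_nat q) ^ (card A - rk G g A))"
    if "A \<in> Pow E" for A
  proof -
    have A: "A \<subseteq> E" using that by simp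
    \<comment> \<open>For a = rk(A), d = |A|, e = rk(E), c = |E|, the sum on the right is c + d - 2
      a, of the same parity as c - d.\<close>
    have parity: "even (c - d) \<longleftrightarrow> even ((c - e) + (e - a) + (d - a))"
      if "a \<le> e" "a \<le> d" "e \<le> c" "d \<le> c" for a c d e :: nat
      using that by presburger
    have "rk G g A \<le> rk G g E" "rk G g A \<le> card A" "rk G g E \<le> card E" "card A \<le> card E"
      using rk_mono [OF fin_E g A] rk_le_card [OF finite_sub [OF A] g_sub [OF A]]
        rk_le_card [OF fin_E g] card_mono [OF fin_E A] by auto
    then have "even (card E - card A) \<longleftrightarrow>
        even ((card E - rk G g E) + (rk G g E - rk G g A) + (card A - rk G g A))"
      by (rule parity)
    then have "(-1 :: rat) ^ (card E - card A) =
        (-1) ^ (card E - rk G g E) * (-1) ^ (rk G g E - rk G g A) * (-1) ^ (card A - rk G g A)"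
      unfolding power_add [symmetric] by (simp add: minus_one_power_iff)
    then show ?thesis
      by (simp add: power_minus [of "of_nat q"] field_simps)
  qed
  then show ?thesis
    unfolding chi_star_expansion [OF q] tutte_quasi_poly_def sum_distrib_left
    by (intro sum.cong refl) simp
qed

text \<open>Both evaluation points (1 - q, 0) and (0, 1 - q) satisfy the second hypothesis, so every
  ratio in the sum is taken at q and equals 1.\<close>

lemma tutte_quasi_poly_Z_M:
  assumes "q \<in> Z_M G g E" "(x - 1) * (y - 1) = int q"
  shows "tutte_quasi_poly G g E x y = tutte_poly G g E (of_int x) (of_int y)"
  unfolding tutte_quasi_poly_def tutte_poly_def assms(2)
  using torsion_ratio_Z_M [OF _ assms(1)] by (intro sum.cong refl) auto

lemma tutte_quasi_poly_Z_A:
  assumes "q \<in> Z_A G g E" "(x - 1) * (y - 1) = int q"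
  shows "tutte_quasi_poly G g E x y = arith_tutte_poly G g E (of_int x) (of_int y)"
  unfolding tutte_quasi_poly_def arith_tutte_poly_def assms(2)
  using torsion_ratio_Z_A [OF _ assms(1)] by (intro sum.cong refl) auto

end

text \<open>The flow formula is normalised by the torsion ratio at the empty set, which differs from
  m({}) in general: for E empty, G = Z/3 and q = 2 there is one flow and the quasi-polynomial is 1,
  while m({}) = 3. The factor is 1 for q in \<open>Z_M\<close> and becomes m({}) for q in
  \<open>Z_A\<close>. It is needed there too: with q = 3 in the same example the arithmetic Tutte
  polynomial is 3 and there is still one flow.\<close>

theorem theorem9p1:
  fixes G :: "('a, 'b) monoid_scheme" and g :: "'e \<Rightarrow> 'a" and E :: "'e set" and q :: nat
  assumes "comm_group G" and "finitely_generated_group G"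
    and "finite E" and "g \<in> E \<rightarrow> carrier G"
    and "q > 0"
  shows
    "(of_nat (chi G g E q) :: rat) =
        (-1) ^ rk G g E * of_nat q ^ (abelian_rank G - rk G g E) *
          tutte_quasi_poly G g E (1 - int q) 0 \<and>
     (of_nat (chi_star G g E q) :: rat) =
        (-1) ^ (card E - rk G g E) * inverse (torsion_ratio G g (int q) {}) *
          tutte_quasi_poly G g E 0 (1 - int q) \<and>
     (q \<in> Z_M G g E \<longrightarrow>
       (of_nat (chi G g E q) :: rat) =
          (-1) ^ rk G g E * of_nat q ^ (abelian_rank G - rk G g E) *
            tutte_poly G g E (1 - of_nat q) 0 \<and>
       (of_nat (chi_star G g E q) :: rat) =
          (-1) ^ (card E - rk G g E) * tutte_poly G g E 0 (1 - of_nat q)) \<and>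
     (q \<in> Z_A G g E \<longrightarrow>
       (of_nat (chi G g E q) :: rat) =
          (-1) ^ rk G g E * of_nat q ^ (abelian_rank G - rk G g E) *
            arith_tutte_poly G g E (1 - of_nat q) 0 \<and>
       (of_nat (chi_star G g E q) :: rat) =
          (-1) ^ (card E - rk G g E) * inverse (of_nat (arith_mult G g {})) *
            arith_tutte_poly G g E 0 (1 - of_nat q))"
proof -
  obtain U where "finite U" "U \<subseteq> carrier G" "generate G U = carrier G"
    using assms(2) by (auto simp: finitely_generated_group_def)
  then interpret abelian_list G g E U
    using assms by (intro abelian_list.intro abelian_list_axioms.intro) auto
  show ?thesis
    using chi_eq [OF assms(5)] chi_star_eq [OF assms(5)]
      tutte_quasi_poly_Z_M [of q "1 - int q" 0] tutte_quasi_poly_Z_M [of q 0 "1 - int q"]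
      tutte_quasi_poly_Z_A [of q "1 - int q" 0] tutte_quasi_poly_Z_A [of q 0 "1 - int q"]
      torsion_ratio_Z_M [of "{}" q] torsion_ratio_Z_A [of "{}" q]
    by simp
qed

end
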